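(* Assume the following. (1) For $\mu$-a.e. $s\in E$, the operator $A(s,\cdot)$ is maximal monotone; and for every $\lambda>0$ and $x\in\mathcal H$, the map $s\mapsto J_\lambda(s,x)$ is $\mathcal E/\mathcal B(\mathcal H)$-measurable. (2) $(\lambda_n)_{n\in\mathbb N}$ is a sequence of positive reals with $\sum_n\lambda_n=+\infty$ and $\sum_n\lambda_n^2<\infty$; the random variables $(\xi_n)_{n\ge1}$ are independent and identically distributed with distribution $\mu$. (3) The monotone operator $\underline A$ is maximal. Suppose moreover that $\mathcal Z_A(2)\ne\emptyset$. Let $x_0\in\mathcal H$ be fixed and let $(x_n)$ be the random sequence defined by $x_{n+1}=J_{\lambda_n}(\xi_{n+1},x_n)$, $n\in\mathbb N$, with weighted averages $\overline x_n=\sum_{k=1}^n\lambda_kx_k/\sum_{k=1}^n\lambda_k$. Let $G\in\mathcal F$ be an event such that for almost every $\omega\in G$ the sequence $(x_n(\omega))$ has the property $\overline{UI}$. Then there exists $B\in\mathcal F$ with $\mathbb P(B)=1$ such that for every $\omega\in B\cap G$, all weak cluster points of the sequence $(\overline x_n(\omega))$ belong to $\mathrm{zer}(\underline A)$.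
   Context: $(E,\mathcal E,\mu)$ is a complete probability space, $\mathcal H$ is a separable Hilbert space with Borel $\sigma$-algebra $\mathcal B(\mathcal H)$, $A:E\times\mathcal H\to2^{\mathcal H}$ is a set-valued mapping, $(\Omega,\mathcal F,\mathbb P)$ is a probability space and $\xi_n:\Omega\to E$ ($n\ge1$) are random variables. For $\lambda>0$, $J_\lambda(s,x)=(I+\lambda A(s,\cdot))^{-1}(x)$ is the resolvent and $A_\lambda(s,x)=(x-J_\lambda(s,x))/\lambda$ the Yosida approximation (both single-valued and defined on all of $\mathcal H$ whenever $A(s,\cdot)$ is maximal monotone). For $x\in\mathcal H$ and $p\ge1$, $S_A^p(x)$ is the set of measurable functions $\phi:E\to\mathcal H$ with $\phi(s)\in A(s,x)$ for $\mu$-a.e. $s$ and $\int\|\phi\|^p d\mu<\infty$. The mean operator is the Aumann integral $\underline A(x)=\int A(s,x)\,d\mu(s)=\{\int\phi\,d\mu:\phi\in S_A^1(x)\}$ (Bochner integrals). $\mathrm{zer}(\underline A)=\{x: 0\in\underline A(x)\}$ and $\mathcal Z_A(p)=\{x\in\mathcal H:\exists\phi\in S_A^p(x),\ \int\phi\,d\mu=0\}$. A family $(f_i)_{i\in I}$ of measurable functions $E\to\mathbb R_+$ is uniformly integrable if $\lim_{a\to+\infty}\sup_i\int_{\{f_i>a\}}f_i\,d\mu=0$. A sequence $(u_n)_{n\ge1}$ in $\mathcal H$ has the property $\overline{UI}$ if the sequence of functions of $s$ given by $\frac{\sum_{k=1}^n\lambda_k\|A_{\lambda_k}(\cdot,u_k)\|}{\sum_{k=1}^n\lambda_k}$,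 $n\ge1$, is uniformly integrable. *)

theory Defs
  imports "HOL-Probability.Probability"
begin

text \<open>The operator property is named with a suffix because \<^const>\<open>monotone\<close> is the
  order-theoretic notion.\<close>

definition op_graph :: "('h \<Rightarrow> 'h set) \<Rightarrow> ('h \<times> 'h) set"
  where "op_graph T = {(x, u). u \<in> T x}"

definition monotone_operator :: "('h::real_inner \<Rightarrow> 'h set) \<Rightarrow> bool"
  where "monotone_operator T \<longleftrightarrow>
    (\<forall>x y. \<forall>u\<in>T x. \<forall>v\<in>T y. 0 \<le> inner (u - v) (x - y))"

definition maximal_monotone :: "('h::real_inner \<Rightarrow> 'h set) \<Rightarrow> bool"
  where "maximal_monotone T \<longleftrightarrow> monotone_operator T \<and>
    (\<forall>T'. monotone_operator T' \<and> op_graph T \<subseteq> op_graph T' \<longrightarrow> op_graph T' = op_graph T)"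

definition zer :: "('h::zero \<Rightarrow> 'h set) \<Rightarrow> 'h set"
  where "zer T = {x. 0 \<in> T x}"

definition inv_operator :: "('h \<Rightarrow> 'h set) \<Rightarrow> 'h \<Rightarrow> 'h set"
  where "inv_operator T x = {y. x \<in> T y}"

text \<open>The inverse of \<open>I + lam A(s, .)\<close> is everywhere single-valued when \<open>A s\<close> is maximal monotone
  and \<open>lam > 0\<close>; otherwise \<^const>\<open>the_elem\<close> may give an unspecified value.\<close>

definition resolvent :: "('e \<Rightarrow> 'h \<Rightarrow> 'h set) \<Rightarrow> real \<Rightarrow> 'e \<Rightarrow> 'h \<Rightarrow> 'h::real_inner"
  where "resolvent A lam s x =
    the_elem (inv_operator (\<lambda>y. (\<lambda>u. y + lam *\<^sub>R u) ` A s y) x)"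

definition yosida :: "('e \<Rightarrow> 'h \<Rightarrow> 'h set) \<Rightarrow> real \<Rightarrow> 'e \<Rightarrow> 'h \<Rightarrow> 'h::real_inner"
  where "yosida A lam s x = (x - resolvent A lam s x) /\<^sub>R lam"

lemma resolvent_eqI:
  assumes "monotone_operator (A s)" "0 < lam" "u \<in> A s y" "x = y + lam *\<^sub>R u"
  shows "resolvent A lam s x = y"
proof -
  have "y' = y" if "u' \<in> A s y'" "x = y' + lam *\<^sub>R u'" for y' u'
  proof -
    have "0 \<le> inner (u' - u) (y' - y)"
      using assms that by (auto simp: monotone_operator_def)
    then have "0 \<le> inner (lam *\<^sub>R (u' - u)) (y' - y)"
      using assms by simp
    moreover have "lam *\<^sub>R (u' - u) = - (y' - y)"
      using assms(4) that(2) by (simp add: algebra_simps)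
    ultimately have "inner (y' - y) (y' - y) \<le> 0"
      by (metis inner_minus_left neg_0_le_iff_le)
    then show ?thesis
      by (metis inner_gt_zero_iff not_le right_minus_eq)
  qed
  then have "inv_operator (\<lambda>y. (\<lambda>u. y + lam *\<^sub>R u) ` A s y) x = {y}"
    using assms by (auto simp: inv_operator_def)
  then show ?thesis
    by (simp add: resolvent_def)
qed

definition selections ::
  "'e measure \<Rightarrow> ('e \<Rightarrow> 'h \<Rightarrow> 'h set) \<Rightarrow> real \<Rightarrow> 'h \<Rightarrow> ('e \<Rightarrow> 'h::real_normed_vector) set"
  where "selections M A p x = {\<phi> \<in> borel_measurable M.
    (AE s in M. \<phi> s \<in> A s x) \<and> (\<integral>\<^sup>+ s. ennreal (norm (\<phi> s) powr p) \<partial>M) < \<infinity>}"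

definition mean_operator ::
  "'e measure \<Rightarrow> ('e \<Rightarrow> 'h \<Rightarrow> 'h set) \<Rightarrow> 'h \<Rightarrow> ('h::{banach, second_countable_topology}) set"
  where "mean_operator M A x = {(\<integral>s. \<phi> s \<partial>M) |\<phi>. \<phi> \<in> selections M A 1 x}"

definition zer_sel ::
  "'e measure \<Rightarrow> ('e \<Rightarrow> 'h \<Rightarrow> 'h set) \<Rightarrow> real \<Rightarrow> ('h::{banach, second_countable_topology}) set"
  where "zer_sel M A p = {x. \<exists>\<phi>\<in>selections M A p x. (\<integral>s. \<phi> s \<partial>M) = 0}"

definition uniformly_integrable :: "'e measure \<Rightarrow> 'i set \<Rightarrow> ('i \<Rightarrow> 'e \<Rightarrow> real) \<Rightarrow> bool"
  where "uniformly_integrable M I f \<longleftrightarrow>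
    (\<forall>i\<in>I. f i \<in> borel_measurable M \<and> (\<forall>s\<in>space M. 0 \<le> f i s)) \<and>
    ((\<lambda>a. SUP i\<in>I. \<integral>\<^sup>+ s \<in> {s \<in> space M. f i s > a}. ennreal (f i s) \<partial>M) \<longlongrightarrow> 0) at_top"

definition UI_bar ::
  "'e measure \<Rightarrow> ('e \<Rightarrow> 'h \<Rightarrow> 'h set) \<Rightarrow> (nat \<Rightarrow> real) \<Rightarrow> (nat \<Rightarrow> 'h::real_inner) \<Rightarrow> bool"
  where "UI_bar M A lam u \<longleftrightarrow> uniformly_integrable M {1..}
    (\<lambda>n s. (\<Sum>k=1..n. lam k * norm (yosida A (lam k) s (u k))) / (\<Sum>k=1..n. lam k))"

text \<open>The coarsest topology making every continuous linear functional continuous, as the pullback of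
  the product topology on the functions from the dual space to the reals.\<close>

definition weak_topology :: "('h::real_normed_vector) topology"
  where "weak_topology =
    pullback_topology UNIV (\<lambda>x (f :: 'h \<Rightarrow>\<^sub>L real). blinfun_apply f x) euclidean"

definition weak_cluster_point :: "(nat \<Rightarrow> 'h::real_normed_vector) \<Rightarrow> 'h \<Rightarrow> bool"
  where "weak_cluster_point u z \<longleftrightarrow>
    (\<forall>U. openin weak_topology U \<and> z \<in> U \<longrightarrow> (\<exists>\<^sub>F n in sequentially. u n \<in> U))"

end

theory Submission
  imports Defs
begin

text \<open>
  By maximality of the mean operator, a point \<open>z\<close> is a zero as soon as \<open>\<langle>m, z - u\<rangle> \<le> 0\<close> for every
  pair \<open>(u, m)\<close> of its graph (\<open>maximal_monotone_memI\<close>), that is, for \<open>m = \<integral> \<psi> d\<mu>\<close> with \<open>\<psi>\<close> an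
  integrable selection of \<open>A(., u)\<close>. So it suffices to show that almost surely, simultaneously for
  all these pairs, the upper limit of \<open>\<langle>m, xbar n - u\<rangle>\<close> is at most \<open>0\<close>; this passes to weak cluster
  points because \<open>x \<mapsto> \<langle>m, x\<rangle>\<close> is weakly continuous.

  Write \<open>y n\<close> for the Yosida approximation of index \<open>lam n\<close> at \<open>(\<xi> (n + 1), x n)\<close>, so that
  \<open>x (n + 1) = x n - lam n y n\<close>, and \<open>h n x\<close> for the \<open>\<mu>\<close>-mean of the Yosida approximation at \<open>x\<close>, which
  is the conditional mean of \<open>y n\<close> at \<open>x = x n\<close>. That the resolvents are everywhere defined is Minty's
  theorem (\<open>Minty\<close>).

  Comparing the iterates with a point of \<open>Z\<^sub>A(2)\<close> gives a descent inequality with an error of order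
  \<open>(lam n)\<^sup>2\<close> and a martingale difference (\<open>resolvent_descent\<close>). Taking expectations, the second moments of
  \<open>x n\<close> are bounded and \<open>\<Sum> (lam n)\<^sup>2 E |y n|\<^sup>2 < \<infinity>\<close>; a martingale whose differences have summable second
  moments has bounded partial sums almost surely (\<open>AE_partial_sums_bounded\<close>), whence \<open>x n\<close> is
  bounded almost surely.

  For fixed \<open>u\<close>, expanding \<open>|x (n + 1) - u|\<^sup>2\<close> shows that \<open>\<Sum> lam k \<langle>y k, x k - u\<rangle>\<close> is bounded, and
  \<open>y k\<close> may be replaced by \<open>h k (x k)\<close> at the price of a martingale (\<open>AE_drift_bounded\<close>). Since
  \<open>\<Sum> lam k = \<infinity>\<close>, the weighted averages of \<open>\<langle>h k (x k), x k - u\<rangle>\<close> tend to \<open>0\<close>, first for \<open>u\<close> in a countable dense set outside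
  one null set, then for all \<open>u\<close> (\<open>avg_drift_le\<close>).

  It remains to bound \<open>\<langle>m, x k - u\<rangle>\<close> by \<open>\<langle>h k (x k), x k - u\<rangle>\<close> up to an error that vanishes on average. Where
  \<open>|\<psi>| \<le> b\<close>, monotonicity yields this with the error \<open>lam k b\<^sup>2 / 4\<close> (\<open>yosida_almost_monotone\<close>). The
  set where \<open>|\<psi>| > b\<close> contributes at most a constant times the integrals over it of \<open>|\<psi>|\<close> and of the
  averaged norms of the Yosida approximations, and both are small for large \<open>b\<close>, the second uniformly
  in \<open>n\<close> by uniform integrability (\<open>averages_limit\<close>).
\<close>

section \<open>Maximal monotone operators have everywhere defined resolvents\<close>

text \<open>
  The set \<open>K\<close> to have in mind consists of the convex combinations \<open>(c, r)\<close> of points \<open>((z + w)/2, \<langle>z, w\<rangle>)\<close>. Then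
  \<open>|y - c|\<^sup>2 - |c|\<^sup>2 + r = |y|\<^sup>2 - 2\<langle>y, c\<rangle> + r\<close> is the same combination of the numbers
  \<open>\<langle>y - z, y - w\<rangle>\<close>. So the lemma is a minimax statement: if each convex combination of these
  quadratic functions has a minimum \<open>r - |c|\<^sup>2 \<le> 0\<close>, then one \<open>y\<close> makes all of them nonpositive.
  Along combinations for which \<open>r - |c|\<^sup>2\<close> tends to its supremum \<open>d\<close>, the
  minimisers \<open>c\<close> form a Cauchy sequence, by strong concavity of \<open>r - |c|\<^sup>2\<close> (the identity \<open>mix\<close>), and
  comparing with the combinations that put a small weight \<open>t\<close> on another point shows that the limit works.
\<close>

lemma convex_paraboloid_center:
  fixes K :: "('h::{real_inner, complete_space} \<times> real) set"
  assumes K: "convex K" and le: "\<And>c r. (c, r) \<in> K \<Longrightarrow> r \<le> (norm c)\<^sup>2"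
  shows "\<exists>y. \<forall>(c, r)\<in>K. (norm (y - c))\<^sup>2 \<le> (norm c)\<^sup>2 - r"
proof (cases "K = {}")
  case True
  then show ?thesis by auto
next
  case False
  define q :: "'h \<times> real \<Rightarrow> real" where "q = (\<lambda>(c, r). r - (norm c)\<^sup>2)"
  have q: "q (c, r) = r - (norm c)\<^sup>2" for c r
    by (simp add: q_def)
  have bdd: "bdd_above (q ` K)"
    using le by (auto simp: q_def bdd_above_def intro!: exI[of _ 0] split: prod.splits)
  define d where "d = Sup (q ` K)"
  have q_le: "q p \<le> d" if "p \<in> K" for p
    unfolding d_def using bdd that by (auto intro: cSup_upper)
  have d0: "d \<le> 0"
    unfolding d_def using False le by (intro cSup_least) (auto simp: q_def)
  have mix: "q ((1 - t) *\<^sub>R c + t *\<^sub>R c', (1 - t) * r + t * r')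
      = (1 - t) * q (c, r) + t * q (c', r') + t * (1 - t) * (norm (c - c'))\<^sup>2" for t c r c' r'
    unfolding q power2_norm_eq_inner by (simp add: algebra_simps inner_commute)
  have conv: "((1 - t) *\<^sub>R c + t *\<^sub>R c', (1 - t) * r + t * r') \<in> K"
    if "(c, r) \<in> K" "(c', r') \<in> K" "0 \<le> t" "t \<le> 1" for t c r c' r'
    using convexD_alt[OF K that(1,2), of t] that(3,4) by simp
  have "\<exists>p\<in>K. d - inverse (Suc n) < q p" for n
  proof -
    have "d - inverse (real (Suc n)) < Sup (q ` K)"
      unfolding d_def by simp
    then show ?thesis
      using less_cSup_iff[of "q ` K"] False bdd by auto
  qed
  then obtain p where p: "\<And>n. p n \<in> K" "\<And>n. d - inverse (real (Suc n)) < q (p n)"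
    by metis
  define c where "c n = fst (p n)" for n
  define r where "r n = snd (p n)" for n
  have pcr: "p n = (c n, r n)" for n
    by (simp add: c_def r_def)
  \<comment> \<open>The midpoint of two almost maximising points cannot exceed the supremum.\<close>
  have near: "(norm (c m - c n))\<^sup>2 \<le> 4 * (inverse (real (Suc N)))"
    if "N \<le> m" "N \<le> n" for m n N
  proof -
    have le_N: "inverse (real (Suc k)) \<le> inverse (real (Suc N))" if "N \<le> k" for k
      using that by (simp add: field_simps)
    have "q ((1 - 1/2) *\<^sub>R c m + (1/2) *\<^sub>R c n, (1 - 1/2) * r m + (1/2) * r n) \<le> d"
      using p(1)[of m] p(1)[of n] unfolding pcr by (intro q_le conv) auto
    then have "q (p m) / 2 + q (p n) / 2 + (norm (c m - c n))\<^sup>2 / 4 \<le> d"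
      unfolding mix pcr by (simp add: field_simps)
    then show ?thesis
      using p(2)[of m] p(2)[of n] le_N[OF that(1)] le_N[OF that(2)] by linarith
  qed
  have "Cauchy c"
  proof (rule metric_CauchyI)
    fix e :: real assume "0 < e"
    then obtain N where N: "inverse (real (Suc N)) < e\<^sup>2 / 4"
      using reals_Archimedean[of "e\<^sup>2 / 4"] by auto
    have "dist (c m) (c n) < e" if "N \<le> m" "N \<le> n" for m n
    proof -
      have "(norm (c m - c n))\<^sup>2 < e\<^sup>2"
        using near[OF that] N by linarith
      then show ?thesis
        using \<open>0 < e\<close> by (simp add: dist_norm power2_less_imp_less)
    qed
    then show "\<exists>N. \<forall>m\<ge>N. \<forall>n\<ge>N. dist (c m) (c n) < e" by auto
  qed
  then obtain y where y: "c \<longlonglongrightarrow> y"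
    using Cauchy_convergent convergent_def by blast
  have q_lim: "(\<lambda>n. q (p n)) \<longlonglongrightarrow> d"
  proof (rule tendsto_sandwich)
    show "(\<lambda>n. d - inverse (real (Suc n))) \<longlonglongrightarrow> d"
      using tendsto_diff[OF tendsto_const LIMSEQ_inverse_real_of_nat, of d] by simp
  qed (use less_imp_le[OF p(2)] q_le[OF p(1)] in auto)
  have "(norm (y - c'))\<^sup>2 \<le> (norm c')\<^sup>2 - r'" if c': "(c', r') \<in> K" for c' r'
  proof -
    have t: "(1 - t) * (norm (y - c'))\<^sup>2 + q (c', r') \<le> d" if "0 < t" "t < 1" for t
    proof -
      have "(1 - t) * q (p n) + t * q (c', r') + t * (1 - t) * (norm (c n - c'))\<^sup>2 \<le> d" for n
        using mix[of t "c n" c' "r n" r']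
          q_le[OF conv[of "c n" "r n" c' r' t]] p(1)[of n] c' that unfolding pcr by simp
      moreover have "(\<lambda>n. (1 - t) * q (p n) + t * q (c', r') + t * (1 - t) * (norm (c n - c'))\<^sup>2)
          \<longlonglongrightarrow> (1 - t) * d + t * q (c', r') + t * (1 - t) * (norm (y - c'))\<^sup>2"
        by (intro tendsto_intros q_lim y)
      ultimately have "(1 - t) * d + t * q (c', r') + t * (1 - t) * (norm (y - c'))\<^sup>2 \<le> d"
        by (meson LIMSEQ_le_const2)
      then have "t * ((1 - t) * (norm (y - c'))\<^sup>2 + q (c', r')) \<le> t * d"
        by (simp add: algebra_simps)
      then show ?thesis using that by simp
    qed
    have "((\<lambda>t. (1 - t) * (norm (y - c'))\<^sup>2 + q (c', r')) \<longlongrightarrow> (1 - 0) * (norm (y - c'))\<^sup>2 + q (c', r'))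
        (at_right 0)"
      by (intro tendsto_intros)
    moreover have "eventually (\<lambda>t::real. (1 - t) * (norm (y - c'))\<^sup>2 + q (c', r') \<le> d) (at_right 0)"
      using eventually_at_right_less[of "0::real"] eventually_at_right_field
      by (auto simp: eventually_at_right_field intro!: exI[of _ 1] t)
    ultimately have "(1 - 0) * (norm (y - c'))\<^sup>2 + q (c', r') \<le> d"
      by (rule tendsto_upperbound) simp
    then show ?thesis using d0 by (simp add: q)
  qed
  then show ?thesis by auto
qed

text \<open>
  For convex weights \<open>u i\<close>, the double sum of \<open>u i u j \<langle>z i - z j, w i - w j\<rangle>\<close> equals
  \<open>2 (r - \<langle>zb, wb\<rangle>)\<close> with the barycentres \<open>zb\<close> and \<open>wb\<close>; all its terms are nonpositive, and
  \<open>\<langle>zb, wb\<rangle> \<le> |(zb + wb)/2|\<^sup>2\<close>.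
\<close>

lemma antitone_pairs_convex_hull_le:
  fixes S :: "('h::real_inner \<times> 'h) set"
  assumes anti: "\<And>z w z' w'. (z, w) \<in> S \<Longrightarrow> (z', w') \<in> S \<Longrightarrow> inner (z - z') (w - w') \<le> 0"
    and cr: "(c, r) \<in> convex hull ((\<lambda>(z, w). ((z + w) /\<^sub>R 2, inner z w)) ` S)"
  shows "r \<le> (norm c)\<^sup>2"
proof -
  obtain k :: nat and u :: "nat \<Rightarrow> real" and p where
    u: "\<forall>i\<in>{1..k}. 0 \<le> u i \<and> p i \<in> (\<lambda>(z, w). ((z + w) /\<^sub>R 2, inner z w)) ` S"
      "sum u {1..k} = 1" "(\<Sum>i=1..k. u i *\<^sub>R p i) = (c, r)"
    using cr unfolding convex_hull_indexed by auto
  then have "\<forall>i\<in>{1..k}. \<exists>z w. (z, w) \<in> S \<and> p i = ((z + w) /\<^sub>R 2, inner z w)"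
    by fast
  then obtain z w where zw: "\<And>i. i \<in> {1..k} \<Longrightarrow> (z i, w i) \<in> S"
    "\<And>i. i \<in> {1..k} \<Longrightarrow> p i = ((z i + w i) /\<^sub>R 2, inner (z i) (w i))"
    by metis
  define zb where "zb = (\<Sum>i=1..k. u i *\<^sub>R z i)"
  define wb where "wb = (\<Sum>i=1..k. u i *\<^sub>R w i)"
  have "(\<Sum>i=1..k. u i *\<^sub>R ((z i + w i) /\<^sub>R 2, inner (z i) (w i))) = (c, r)"
    unfolding u(3)[symmetric] by (intro sum.cong) (simp_all only: zw(2))
  then have *: "c = (\<Sum>i=1..k. u i *\<^sub>R ((z i + w i) /\<^sub>R 2))" "r = (\<Sum>i=1..k. u i * inner (z i) (w i))"
    by (auto simp: prod_eq_iff fst_sum snd_sum)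
  have c: "c = (zb + wb) /\<^sub>R 2"
    unfolding *(1) zb_def wb_def
    by (simp add: scaleR_right.sum sum.distrib scaleR_right_distrib algebra_simps)
  have "0 \<ge> (\<Sum>i=1..k. \<Sum>j=1..k. u i * u j * inner (z i - z j) (w i - w j))"
    using u(1) zw(1) anti by (intro sum_nonpos mult_nonneg_nonpos mult_nonneg_nonneg) auto
  also have "(\<Sum>i=1..k. \<Sum>j=1..k. u i * u j * inner (z i - z j) (w i - w j)) =
      (\<Sum>i=1..k. \<Sum>j=1..k. u j * (u i * inner (z i) (w i))) + (\<Sum>i=1..k. \<Sum>j=1..k. u i * (u j * inner (z j) (w j)))
      - (\<Sum>i=1..k. \<Sum>j=1..k. inner (u i *\<^sub>R z i) (u j *\<^sub>R w j)) - (\<Sum>i=1..k. \<Sum>j=1..k. inner (u j *\<^sub>R z j) (u i *\<^sub>R w i))"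
    by (simp add: algebra_simps flip: sum.distrib sum_subtractf)
  also have "(\<Sum>i=1..k. \<Sum>j=1..k. u j * (u i * inner (z i) (w i))) = r"
    using u(2) unfolding *(2) by (simp flip: sum_distrib_right)
  also have "(\<Sum>i=1..k. \<Sum>j=1..k. u i * (u j * inner (z j) (w j))) = r"
    using u(2) unfolding *(2) by (simp flip: sum_distrib_left sum_distrib_right)
  also have "(\<Sum>i=1..k. \<Sum>j=1..k. inner (u i *\<^sub>R z i) (u j *\<^sub>R w j)) = inner zb wb"
    unfolding zb_def wb_def inner_sum_left inner_sum_right by (rule sum.swap)
  also have "(\<Sum>i=1..k. \<Sum>j=1..k. inner (u j *\<^sub>R z j) (u i *\<^sub>R w i)) = inner zb wb"
    unfolding zb_def wb_def inner_sum_left inner_sum_right ..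
  finally have "r \<le> inner zb wb" by simp
  also have "\<dots> \<le> (norm c)\<^sup>2"
  proof -
    have "(norm c)\<^sup>2 - inner zb wb = (norm ((zb - wb) /\<^sub>R 2))\<^sup>2"
      unfolding c power2_norm_eq_inner by (simp add: algebra_simps inner_commute)
    then show ?thesis by (metis diff_ge_0_iff_ge zero_le_power2)
  qed
  finally show ?thesis .
qed

text \<open>Otherwise adding \<open>u\<close> to \<open>T x\<close> would give a strictly larger monotone operator.\<close>

lemma maximal_monotone_memI:
  assumes "maximal_monotone T" "\<And>y v. v \<in> T y \<Longrightarrow> 0 \<le> inner (v - u) (y - x)"
  shows "u \<in> T x"
proof -
  define T' where "T' y = (if y = x then insert u (T y) else T y)" for y
  have mT: "monotone_operator T"
    using assms(1) by (simp add: maximal_monotone_def)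
  have sym: "0 \<le> inner (u - v) (x - y)" if "v \<in> T y" for y v
  proof -
    have "inner (u - v) (x - y) = inner (v - u) (y - x)"
      by (simp add: algebra_simps)
    then show ?thesis using assms(2)[OF that] by simp
  qed
  have "monotone_operator T'"
    using mT assms(2) sym unfolding monotone_operator_def T'_def by auto
  moreover have "op_graph T \<subseteq> op_graph T'"
    by (auto simp: op_graph_def T'_def)
  ultimately have "op_graph T' = op_graph T"
    using assms(1) by (auto simp: maximal_monotone_def)
  moreover have "(x, u) \<in> op_graph T'"
    by (simp add: op_graph_def T'_def)
  ultimately show ?thesis by (simp add: op_graph_def)
qed

text \<open>
  The point \<open>y\<close> sought is one for which \<open>u = (x - y)/lam\<close> is monotonically related to all \<open>(z, v)\<close> in
  the graph; by maximality \<open>u\<close> then lies in \<open>T y\<close>. With \<open>w = x - lam v\<close> that relation reads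
  \<open>\<langle>y - z, y - w\<rangle> \<le> 0\<close>, and monotonicity of \<open>T\<close> says that \<open>z\<close> and \<open>w\<close> vary in opposite directions.
\<close>

lemma Minty:
  fixes T :: "'h::{real_inner, complete_space} \<Rightarrow> 'h set"
  assumes "maximal_monotone T" "0 < lam"
  shows "\<exists>y u. u \<in> T y \<and> x = y + lam *\<^sub>R u"
proof -
  define S where "S = {(z, x - lam *\<^sub>R v) |z v. v \<in> T z}"
  let ?f = "\<lambda>(z::'h, w). ((z + w) /\<^sub>R 2, inner z w)"
  have "inner (z - z') (w - w') \<le> 0" if "(z, w) \<in> S" "(z', w') \<in> S" for z w z' w'
  proof -
    obtain v v' where v: "w = x - lam *\<^sub>R v" "v \<in> T z" "w' = x - lam *\<^sub>R v'" "v' \<in> T z'"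
      using \<open>(z, w) \<in> S\<close> \<open>(z', w') \<in> S\<close> by (auto simp: S_def)
    have "0 \<le> lam * inner (v - v') (z - z')"
      using assms v by (auto simp: maximal_monotone_def monotone_operator_def)
    also have "\<dots> = - inner (z - z') (w - w')"
      unfolding v by (simp add: algebra_simps inner_commute)
    finally show ?thesis by simp
  qed
  then have "\<exists>y. \<forall>(c, r)\<in>convex hull (?f ` S). (norm (y - c))\<^sup>2 \<le> (norm c)\<^sup>2 - r"
    by (intro convex_paraboloid_center antitone_pairs_convex_hull_le) auto
  then obtain y where y: "\<And>c r. (c, r) \<in> convex hull (?f ` S) \<Longrightarrow> (norm (y - c))\<^sup>2 \<le> (norm c)\<^sup>2 - r"
    by auto
  define u where "u = (x - y) /\<^sub>R lam"
  have x: "x = y + lam *\<^sub>R u"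
    using assms by (simp add: u_def)
  have "u \<in> T y"
  proof (rule maximal_monotone_memI[OF assms(1)])
    fix z v assume "v \<in> T z"
    define w where "w = x - lam *\<^sub>R v"
    have "(z, w) \<in> S"
      using \<open>v \<in> T z\<close> by (auto simp: S_def w_def)
    then have "((z + w) /\<^sub>R 2, inner z w) \<in> convex hull (?f ` S)"
      by (intro hull_inc) (auto intro: rev_image_eqI)
    from y[OF this] have "inner (y - z) (y - w) \<le> 0"
      unfolding power2_norm_eq_inner by (simp add: algebra_simps inner_commute)
    moreover have "inner (y - z) (y - w) = - (lam * inner (v - u) (z - y))"
      unfolding w_def x by (simp add: algebra_simps inner_commute)
    ultimately show "0 \<le> inner (v - u) (z - y)"
      using assms(2) by (simp add: zero_le_mult_iff)
  qed
  with x show ?thesis by blast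
qed

section \<open>Resolvents and Yosida approximations\<close>

lemma yosida_eq: "0 < lam \<Longrightarrow> x = resolvent A lam s x + lam *\<^sub>R yosida A lam s x"
  by (simp add: yosida_def)

lemma yosida_mem:
  fixes A :: "'e \<Rightarrow> 'h \<Rightarrow> 'h::{real_inner, complete_space} set"
  assumes "maximal_monotone (A s)" "0 < lam"
  shows "yosida A lam s x \<in> A s (resolvent A lam s x)"
proof -
  obtain y u where yu: "u \<in> A s y" "x = y + lam *\<^sub>R u"
    using Minty[OF assms] by blast
  have "resolvent A lam s x = y"
    using assms yu by (intro resolvent_eqI) (auto simp: maximal_monotone_def)
  moreover from this have "yosida A lam s x = u"
    using yu(2) assms(2) by (simp add: yosida_def)
  ultimately show ?thesis using yu by simp
qed

lemma yosida_monotone: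
  fixes A :: "'e \<Rightarrow> 'h \<Rightarrow> 'h::{real_inner, complete_space} set"
  assumes "maximal_monotone (A s)" "0 < lam" "u \<in> A s z"
  shows "0 \<le> inner (yosida A lam s x - u) (resolvent A lam s x - z)"
  using assms(1,3) yosida_mem[of A s lam x, OF assms(1,2)]
  by (auto simp: maximal_monotone_def monotone_operator_def)

lemma resolvent_nonexpansive:
  fixes A :: "'e \<Rightarrow> 'h \<Rightarrow> 'h::{real_inner, complete_space} set"
  assumes "maximal_monotone (A s)" "0 < lam"
  shows "norm (resolvent A lam s x - resolvent A lam s y) \<le> norm (x - y)"
proof -
  let ?J = "resolvent A lam s x - resolvent A lam s y" and ?Y = "yosida A lam s x - yosida A lam s y"
  have xy: "x - y = ?J + lam *\<^sub>R ?Y"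
    using yosida_eq[OF assms(2), of x A s] yosida_eq[OF assms(2), of y A s]
    by (simp add: algebra_simps)
  have "0 \<le> inner ?Y ?J"
    by (intro yosida_monotone assms yosida_mem)
  then have "(norm ?J)\<^sup>2 \<le> (norm (x - y))\<^sup>2"
    unfolding xy power2_norm_eq_inner using assms(2)
    by (simp add: inner_left_distrib inner_right_distrib inner_commute)
  then show ?thesis by (rule power2_le_imp_le) simp
qed

lemma norm_yosida_diff_le:
  fixes A :: "'e \<Rightarrow> 'h \<Rightarrow> 'h::{real_inner, complete_space} set"
  assumes "maximal_monotone (A s)" "0 < lam"
  shows "norm (yosida A lam s x - yosida A lam s y) \<le> 2 * norm (x - y) / lam"
proof -
  have "lam *\<^sub>R (yosida A lam s x - yosida A lam s y)
      = (x - y) - (resolvent A lam s x - resolvent A lam s y)"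
    using assms(2) by (simp add: yosida_def algebra_simps)
  then have "lam * norm (yosida A lam s x - yosida A lam s y)
      = norm ((x - y) - (resolvent A lam s x - resolvent A lam s y))"
    using assms(2) by (metis abs_of_pos norm_scaleR)
  also have "\<dots> \<le> 2 * norm (x - y)"
    using norm_triangle_ineq4[of "x - y"] resolvent_nonexpansive[of A s lam x y, OF assms]
    by (smt (verit))
  finally show ?thesis using assms(2) by (simp add: field_simps)
qed

text \<open>
  Monotonicity between \<open>z\<close> and its resolvent, which differ by \<open>lam\<close> times the Yosida approximation \<open>Y\<close>,
  gives \<open>|Y|\<^sup>2 \<le> \<langle>u, Y\<rangle>\<close>.
\<close>

lemma norm_yosida_le:
  fixes A :: "'e \<Rightarrow> 'h \<Rightarrow> 'h::{real_inner, complete_space} set"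
  assumes "maximal_monotone (A s)" "0 < lam" "u \<in> A s z"
  shows "norm (yosida A lam s z) \<le> norm u"
proof -
  let ?Y = "yosida A lam s z"
  have "0 \<le> inner (?Y - u) (resolvent A lam s z - z)"
    using assms by (rule yosida_monotone)
  also have "resolvent A lam s z - z = - (lam *\<^sub>R ?Y)"
    using yosida_eq[OF assms(2), of z A s] by (simp add: algebra_simps)
  finally have "lam * inner ?Y ?Y \<le> lam * inner u ?Y"
    by (simp add: algebra_simps)
  then have "norm ?Y * norm ?Y \<le> norm u * norm ?Y"
    using assms(2) norm_cauchy_schwarz[of u ?Y]
    by (simp add: power2_norm_eq_inner flip: power2_eq_square)
  then show ?thesis
    by (cases "?Y = 0") auto
qed

text \<open>
  The zero operator, whose resolvent is the identity, will replace \<open>A(s, .)\<close> for the exceptional \<open>s\<close>: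
  then every \<open>A(s, .)\<close> is maximal monotone and the resolvent is jointly measurable everywhere.
\<close>

lemma maximal_monotone_zero: "maximal_monotone (\<lambda>_::'h::real_inner. {0})"
  unfolding maximal_monotone_def
proof (intro conjI allI impI)
  show "monotone_operator (\<lambda>_::'h. {0})"
    by (simp add: monotone_operator_def)
next
  fix T' :: "'h \<Rightarrow> 'h set"
  assume T': "monotone_operator T' \<and> op_graph (\<lambda>_. {0}) \<subseteq> op_graph T'"
  have "u = 0" if "u \<in> T' x" for u x
  proof -
    have "0 \<in> T' (x + u)"
      using T' by (auto simp: op_graph_def)
    then have "0 \<le> inner (u - 0) (x - (x + u))"
      using T' that unfolding monotone_operator_def by blast
    then have "inner u u \<le> 0" by simp
    then show ?thesis by (metis inner_eq_zero_iff inner_ge_zero order_antisym)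
  qed
  then show "op_graph T' = op_graph (\<lambda>_. {0})"
    using T' by (auto simp: op_graph_def)
qed

lemma resolvent_zero_operator:
  "A s = (\<lambda>_. {0}) \<Longrightarrow> 0 < r \<Longrightarrow> resolvent A r s y = y"
  by (rule resolvent_eqI[where u=0]) (auto simp: monotone_operator_def)

lemma resolvent_cong: "A s = A' s \<Longrightarrow> resolvent A r s y = resolvent A' r s y"
  by (simp add: resolvent_def)

text \<open>
  The Yosida approximation belongs to the operator at the resolvent \<open>J = x - lam Y\<close>, not at \<open>x\<close>; moving
  from \<open>J\<close> to \<open>x\<close> costs \<open>lam \<langle>Y - u, Y\<rangle> = lam (|Y - u/2|\<^sup>2 - |u|\<^sup>2/4)\<close>.
\<close>

lemma yosida_almost_monotone:
  fixes A :: "'e \<Rightarrow> 'h \<Rightarrow> 'h::{real_inner, complete_space} set"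
  assumes "maximal_monotone (A s)" "0 < lam" "u \<in> A s z"
  shows "- (lam * (norm u)\<^sup>2 / 4) \<le> inner (yosida A lam s x - u) (x - z)"
proof -
  define J where "J = resolvent A lam s x"
  define Y where "Y = yosida A lam s x"
  have x: "x = J + lam *\<^sub>R Y"
    using yosida_eq[OF assms(2)] unfolding J_def Y_def .
  have "0 \<le> inner (Y - u) (J - z)"
    using yosida_monotone[of A s lam u z x, OF assms] unfolding J_def Y_def .
  moreover have "0 \<le> lam * (norm (Y - (1/2) *\<^sub>R u))\<^sup>2"
    using assms(2) by simp
  moreover have "inner (Y - u) (x - z) + lam * (norm u)\<^sup>2 / 4
      = inner (Y - u) (J - z) + lam * (norm (Y - (1/2) *\<^sub>R u))\<^sup>2"
    unfolding x power2_norm_eq_inner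
    by (simp add: inner_add_left inner_add_right inner_diff_left inner_diff_right inner_commute field_simps)
  ultimately show ?thesis unfolding Y_def by linarith
qed

text \<open>
  One step of the iteration. The inner product on the right is taken with \<open>x\<close>, not with the
  resolvent, so that its conditional mean vanishes when \<open>u\<close> is a centred random selection that is independent of
  \<open>x\<close>. The term in \<open>|yosida|\<^sup>2\<close> is what makes \<open>\<Sum> (lam n)\<^sup>2 |y n|\<^sup>2\<close> summable.
\<close>

lemma resolvent_descent:
  fixes A :: "'e \<Rightarrow> 'h \<Rightarrow> 'h::{real_inner, complete_space} set"
  assumes "maximal_monotone (A s)" "0 < lam" "u \<in> A s z"
  shows "(norm (resolvent A lam s x - z))\<^sup>2 + lam\<^sup>2 * (norm (yosida A lam s x))\<^sup>2 / 2
    \<le> (norm (x - z))\<^sup>2 - 2 * (lam * inner u (x - z)) + 2 * (lam\<^sup>2 * (norm u)\<^sup>2)"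
proof -
  define J where "J = resolvent A lam s x"
  define Y where "Y = yosida A lam s x"
  have x: "x = J + lam *\<^sub>R Y"
    using yosida_eq[OF assms(2)] unfolding J_def Y_def .
  have "0 \<le> 2 * lam * inner (Y - u) (J - z)"
    using yosida_monotone[of A s lam u z x, OF assms] assms(2) unfolding J_def Y_def by simp
  moreover have "0 \<le> lam\<^sup>2 * (norm (2 *\<^sub>R u - Y))\<^sup>2 / 2"
    by simp
  moreover have "(norm (x - z))\<^sup>2 - 2 * (lam * inner u (x - z)) + 2 * (lam\<^sup>2 * (norm u)\<^sup>2)
      - ((norm (J - z))\<^sup>2 + lam\<^sup>2 * (norm Y)\<^sup>2 / 2)
      = 2 * lam * inner (Y - u) (J - z) + lam\<^sup>2 * (norm (2 *\<^sub>R u - Y))\<^sup>2 / 2"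
    unfolding x power2_norm_eq_inner
    by (simp add: inner_add_left inner_add_right inner_diff_left inner_diff_right inner_commute
        field_simps power2_eq_square)
  ultimately have "(norm (J - z))\<^sup>2 + lam\<^sup>2 * (norm Y)\<^sup>2 / 2
    \<le> (norm (x - z))\<^sup>2 - 2 * (lam * inner u (x - z)) + 2 * (lam\<^sup>2 * (norm u)\<^sup>2)"
    by linarith
  then show ?thesis unfolding J_def Y_def .
qed

section \<open>Measurability and square integrability\<close>

text \<open>
  With simple functions \<open>q i\<close> that converge pointwise to the identity, \<open>f s (q i x)\<close> is jointly measurable, because
  \<open>q i\<close> takes finitely many values, and converges to \<open>f s x\<close> by continuity.
\<close>

lemma borel_measurable_Caratheodory:
  fixes f :: "'e \<Rightarrow> 'a::{metric_space, second_countable_topology} \<Rightarrow> 'b::metric_space"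
  assumes meas: "\<And>x. (\<lambda>s. f s x) \<in> borel_measurable M"
    and cont: "\<And>s. s \<in> space M \<Longrightarrow> continuous_on UNIV (f s)"
  shows "(\<lambda>(s, x). f s x) \<in> borel_measurable (M \<Otimes>\<^sub>M borel)"
proof -
  obtain q :: "nat \<Rightarrow> 'a \<Rightarrow> 'a" where q: "\<And>i. simple_function borel (q i)" "\<And>x. (\<lambda>i. q i x) \<longlonglongrightarrow> x"
    using borel_measurable_implies_sequence_metric[of "\<lambda>x::'a. x" borel undefined] by auto
  show ?thesis
  proof (rule borel_measurable_LIMSEQ_metric)
    fix i
    have fin: "finite (range (q i))"
      using q(1)[of i] by (simp add: simple_function_def)
    have "(\<lambda>p. f (fst p) (q i (snd p))) \<in> borel_measurable (M \<Otimes>\<^sub>M borel)"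
    proof (rule measurable_compose_countable'[where I="range (q i)" and g="\<lambda>p. q i (snd p)" and f="\<lambda>x p. f (fst p) x"])
      have "q i \<in> measurable borel (count_space (range (q i)))"
        using q(1)[of i] by (simp add: measurable_simple_function simple_function_def
          measurable_count_space_eq2)
      then show "(\<lambda>p. q i (snd p)) \<in> measurable (M \<Otimes>\<^sub>M borel) (count_space (range (q i)))"
        by (rule measurable_compose[OF measurable_snd])
    qed (use meas fin in \<open>auto intro: measurable_compose[OF measurable_fst] countable_finite\<close>)
    then show "(\<lambda>(s, x). f s (q i x)) \<in> borel_measurable (M \<Otimes>\<^sub>M borel)"
      by (simp add: case_prod_beta')
  next
    fix p assume "p \<in> space (M \<Otimes>\<^sub>M (borel :: 'a measure))"
    then have "fst p \<in> space M" by (auto simp: space_pair_measure)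
    then show "(\<lambda>i. case p of (s, x) \<Rightarrow> f s (q i x)) \<longlonglongrightarrow> (case p of (s, x) \<Rightarrow> f s x)"
      using q(2)[of "snd p"] continuous_on_tendsto_compose[OF cont[of "fst p"]]
      by (auto simp: case_prod_beta')
  qed
qed

lemma integrable_mult_of_squares:
  fixes f g :: "'a \<Rightarrow> real"
  assumes [measurable]: "f \<in> borel_measurable M" "g \<in> borel_measurable M"
    and "integrable M (\<lambda>x. (f x)\<^sup>2)" "integrable M (\<lambda>x. (g x)\<^sup>2)"
  shows "integrable M (\<lambda>x. f x * g x)"
proof (rule Bochner_Integration.integrable_bound)
  show "integrable M (\<lambda>x. (f x)\<^sup>2 + (g x)\<^sup>2)" using assms by auto
  show "AE x in M. norm (f x * g x) \<le> norm ((f x)\<^sup>2 + (g x)\<^sup>2)"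
  proof (rule AE_I2)
    fix x
    have "2 * (\<bar>f x\<bar> * \<bar>g x\<bar>) \<le> (f x)\<^sup>2 + (g x)\<^sup>2"
      using sum_squares_bound[of "\<bar>f x\<bar>" "\<bar>g x\<bar>"] by simp
    moreover have "0 \<le> \<bar>f x\<bar> * \<bar>g x\<bar>" by simp
    ultimately have "\<bar>f x\<bar> * \<bar>g x\<bar> \<le> \<bar>(f x)\<^sup>2 + (g x)\<^sup>2\<bar>" by linarith
    then show "norm (f x * g x) \<le> norm ((f x)\<^sup>2 + (g x)\<^sup>2)"
      by (simp add: abs_mult)
  qed
qed simp

lemma integrable_square_add:
  fixes f g :: "'a \<Rightarrow> real"
  assumes [measurable]: "f \<in> borel_measurable M" "g \<in> borel_measurable M"
    and "integrable M (\<lambda>x. (f x)\<^sup>2)" "integrable M (\<lambda>x. (g x)\<^sup>2)"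
  shows "integrable M (\<lambda>x. (f x + g x)\<^sup>2)"
  unfolding power2_sum mult.assoc
  by (intro Bochner_Integration.integrable_add integrable_mult_right integrable_mult_of_squares assms)

lemma (in prob_space) norm_integral_square_le:
  fixes f :: "'a \<Rightarrow> 'b::{banach, second_countable_topology}"
  assumes [measurable]: "f \<in> borel_measurable M" and sq: "integrable M (\<lambda>x. (norm (f x))\<^sup>2)"
  shows "(norm (\<integral>x. f x \<partial>M))\<^sup>2 \<le> (\<integral>x. (norm (f x))\<^sup>2 \<partial>M)"
proof -
  have "integrable M (\<lambda>x. norm (f x))"
    using integrable_mult_of_squares[of "\<lambda>x. norm (f x)" M "\<lambda>_. 1"] sq by simp
  then have "0 \<le> (\<integral>x. (norm (f x))\<^sup>2 \<partial>M) - (\<integral>x. norm (f x) \<partial>M)\<^sup>2"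
    using variance_positive[of "\<lambda>x. norm (f x)"] sq by (simp add: variance_eq)
  moreover have "(norm (\<integral>x. f x \<partial>M))\<^sup>2 \<le> (\<integral>x. norm (f x) \<partial>M)\<^sup>2"
    by (intro power_mono integral_norm_bound) simp
  ultimately show ?thesis by linarith
qed

lemma (in prob_space) integrable_if_square_integrable:
  fixes f :: "'a \<Rightarrow> 'b::{banach, second_countable_topology}"
  assumes [measurable]: "f \<in> borel_measurable M" and sq: "integrable M (\<lambda>x. (norm (f x))\<^sup>2)"
  shows "integrable M f"
  using integrable_mult_of_squares[of "\<lambda>x. norm (f x)" M "\<lambda>_. 1"] sq integrable_norm_cancel[of M f]
  by simp

lemma AE_summable_of_summable_integral:
  fixes f :: "nat \<Rightarrow> 'a \<Rightarrow> real"
  assumes int: "\<And>k. integrable M (f k)" and nonneg: "\<And>k x. 0 \<le> f k x"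
    and sum: "summable (\<lambda>k. \<integral>x. f k x \<partial>M)"
  shows "AE x in M. summable (\<lambda>k. f k x)"
proof -
  have [measurable]: "f k \<in> borel_measurable M" for k
    using int by auto
  have "(\<integral>\<^sup>+x. (\<Sum>k. ennreal (f k x)) \<partial>M) = (\<Sum>k. \<integral>\<^sup>+x. ennreal (f k x) \<partial>M)"
    by (intro nn_integral_suminf) auto
  also have "\<dots> = (\<Sum>k. ennreal (\<integral>x. f k x \<partial>M))"
    using int nonneg by (simp add: nn_integral_eq_integral)
  also have "\<dots> \<noteq> \<infinity>"
    using sum nonneg by (simp add: suminf_ennreal2)
  finally have "AE x in M. (\<Sum>k. ennreal (f k x)) \<noteq> \<infinity>"
    by (intro nn_integral_PInf_AE) auto
  then show ?thesis
    by eventually_elim (auto intro: summable_suminf_not_top nonneg)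
qed

section \<open>Martingales bounded in mean square\<close>

text \<open>
  Conditional centring is stated by testing against square integrable \<open>F n\<close>-measurable functions
  instead of through conditional expectations: Fubini's theorem supplies it directly in this form.
\<close>

locale square_integrable_martingale_differences = prob_space M for M :: "'w measure" +
  fixes F :: "nat \<Rightarrow> 'w measure" and D :: "nat \<Rightarrow> 'w \<Rightarrow> real"
  assumes subalg: "\<And>n. subalgebra M (F n)"
    and filtration: "\<And>n. sets (F n) \<subseteq> sets (F (Suc n))"
    and adapted: "\<And>n. D n \<in> borel_measurable (F (Suc n))"
    and square_integrable: "\<And>n. integrable M (\<lambda>\<omega>. (D n \<omega>)\<^sup>2)"
    and orthogonal: "\<And>n g. g \<in> borel_measurable (F n) \<Longrightarrow> integrable M (\<lambda>\<omega>. (g \<omega>)\<^sup>2)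
      \<Longrightarrow> (\<integral>\<omega>. D n \<omega> * g \<omega> \<partial>M) = 0"
begin

definition S :: "nat \<Rightarrow> 'w \<Rightarrow> real" where "S n \<omega> = (\<Sum>k<n. D k \<omega>)"

lemma space_F: "space (F n) = space M"
  using subalg by (simp add: subalgebra_def)

lemma measurable_M: "f \<in> borel_measurable (F n) \<Longrightarrow> f \<in> borel_measurable M"
  using subalg by (rule measurable_from_subalg)

lemma filtration_le: "m \<le> n \<Longrightarrow> sets (F m) \<subseteq> sets (F n)"
  by (rule lift_Suc_mono_le[of "\<lambda>n. sets (F n)"]) (auto simp: filtration)

lemma measurable_F_mono:
  assumes "f \<in> borel_measurable (F m)" "m \<le> n"
  shows "f \<in> borel_measurable (F n)"
  by (rule measurable_from_subalg[OF _ assms(1)]) (simp add: subalgebra_def space_F filtration_le assms)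

lemma measurable_S: "S n \<in> borel_measurable (F n)"
  unfolding S_def
  by (intro borel_measurable_sum) (auto intro: measurable_F_mono[OF adapted])

text \<open>The increment \<open>D n\<close> is orthogonal to \<open>S n\<close>.\<close>

lemma second_moment:
  "integrable M (\<lambda>\<omega>. (S n \<omega>)\<^sup>2) \<and> (\<integral>\<omega>. (S n \<omega>)\<^sup>2 \<partial>M) = (\<Sum>k<n. \<integral>\<omega>. (D k \<omega>)\<^sup>2 \<partial>M)"
proof (induction n)
  case 0
  then show ?case by (simp add: S_def)
next
  case (Suc n)
  note meas = measurable_M[OF measurable_S] measurable_M[OF adapted]
  have S: "S (Suc n) \<omega> = S n \<omega> + D n \<omega>" for \<omega>
    by (simp add: S_def)
  have int: "integrable M (\<lambda>\<omega>. D n \<omega> * S n \<omega>)"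
    using Suc square_integrable by (intro integrable_mult_of_squares meas) auto
  have "(\<integral>\<omega>. (S (Suc n) \<omega>)\<^sup>2 \<partial>M) = (\<integral>\<omega>. (S n \<omega>)\<^sup>2 + (D n \<omega>)\<^sup>2 + 2 * (D n \<omega> * S n \<omega>) \<partial>M)"
    unfolding S by (simp add: power2_sum algebra_simps)
  also have "\<dots> = (\<Sum>k<n. \<integral>\<omega>. (D k \<omega>)\<^sup>2 \<partial>M) + (\<integral>\<omega>. (D n \<omega>)\<^sup>2 \<partial>M) + 2 * (\<integral>\<omega>. D n \<omega> * S n \<omega> \<partial>M)"
    using Suc square_integrable int by simp
  also have "(\<integral>\<omega>. D n \<omega> * S n \<omega> \<partial>M) = 0"
    using Suc by (intro orthogonal measurable_S) auto
  moreover have "integrable M (\<lambda>\<omega>. (S (Suc n) \<omega>)\<^sup>2)"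
    unfolding S using Suc square_integrable by (intro integrable_square_add meas) auto
  ultimately show ?case by simp
qed

text \<open>
  Stopping at the first time that \<open>|S|\<close> reaches \<open>a\<close> multiplies \<open>D n\<close> by the indicator of an event in \<open>F n\<close>,
  which may be moved to the test function.
\<close>

lemma stopped:
  "square_integrable_martingale_differences M F
    (\<lambda>n \<omega>. if \<forall>j\<le>n. \<bar>S j \<omega>\<bar> < a then D n \<omega> else 0)"
proof -
  let ?I = "\<lambda>n \<omega>. indicator {\<omega>\<in>space (F n). \<forall>j\<le>n. \<bar>S j \<omega>\<bar> < a} \<omega> :: real"
  have I: "?I n \<in> borel_measurable (F n)" for n
  proof -
    have [measurable]: "S j \<in> borel_measurable (F n)" if "j \<le> n" for j
      using that by (rule measurable_F_mono[OF measurable_S])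
    have "{\<omega>\<in>space (F n). \<forall>j\<in>{..n}. \<bar>S j \<omega>\<bar> < a} \<in> sets (F n)"
      by measurable
    then show ?thesis by simp
  qed
  have eq: "(if \<forall>j\<le>n. \<bar>S j \<omega>\<bar> < a then D n \<omega> else 0) = D n \<omega> * ?I n \<omega>" if "\<omega> \<in> space M" for n \<omega>
    using that by (simp add: space_F indicator_def)
  have meas: "(\<lambda>\<omega>. D n \<omega> * ?I n \<omega>) \<in> borel_measurable (F (Suc n))" for n
    by (intro borel_measurable_times adapted measurable_F_mono[OF I]) simp
  show ?thesis
  proof (unfold_locales, goal_cases)
    case (3 n)
    show ?case
      using meas[of n] by (rule measurable_cong[THEN iffD1, rotated]) (simp add: eq space_F)
  next
    case (4 n)
    have "integrable M (\<lambda>\<omega>. (D n \<omega> * ?I n \<omega>)\<^sup>2)"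
    proof (rule Bochner_Integration.integrable_bound[OF square_integrable])
      show "(\<lambda>\<omega>. (D n \<omega> * ?I n \<omega>)\<^sup>2) \<in> borel_measurable M"
        by (intro borel_measurable_power measurable_M[OF meas])
    qed (auto simp: indicator_def)
    then show ?case by (rule Bochner_Integration.integrable_cong[THEN iffD1, rotated 2]) (simp_all add: eq)
  next
    case (5 n g)
    have "integrable M (\<lambda>\<omega>. (?I n \<omega> * g \<omega>)\<^sup>2)"
    proof (rule Bochner_Integration.integrable_bound[OF 5(2)])
      show "(\<lambda>\<omega>. (?I n \<omega> * g \<omega>)\<^sup>2) \<in> borel_measurable M"
        by (intro borel_measurable_power borel_measurable_times measurable_M[OF I] measurable_M[OF 5(1)])
    qed (auto simp: indicator_def)
    then have "(\<integral>\<omega>. D n \<omega> * (?I n \<omega> * g \<omega>) \<partial>M) = 0"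
      by (intro orthogonal borel_measurable_times I 5(1))
    then show ?case
      by (subst Bochner_Integration.integral_cong[OF refl]) (auto simp: eq mult.assoc)
  qed (use subalg filtration in auto)
qed

text \<open>
  On the event \<open>E n\<close> that \<open>|S|\<close> has reached \<open>a\<close> by time \<open>n\<close>, the stopped martingale has kept a value of
  modulus at least \<open>a\<close>, while its second moment is at most \<open>C\<close>. So Markov's inequality for the stopped
  martingale bounds the probability of \<open>E n\<close>.
\<close>

lemma maximal_inequality:
  assumes a: "0 < a" and C: "\<And>n. (\<Sum>k<n. \<integral>\<omega>. (D k \<omega>)\<^sup>2 \<partial>M) \<le> C"
  shows "prob {\<omega>\<in>space M. \<exists>n. a \<le> \<bar>S n \<omega>\<bar>} \<le> C / a\<^sup>2"
proof -
  define D' where "D' n \<omega> = (if \<forall>j\<le>n. \<bar>S j \<omega>\<bar> < a then D n \<omega> else 0)" for n \<omega>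
  interpret stop: square_integrable_martingale_differences M F D'
    using stopped[of a] by (simp add: D'_def[abs_def])
  have [measurable]: "S n \<in> borel_measurable M" for n
    by (rule measurable_M[OF measurable_S])
  have [measurable]: "stop.S n \<in> borel_measurable M" for n
    by (rule measurable_M[OF stop.measurable_S])
  define E where "E n = {\<omega>\<in>space M. \<exists>m\<le>n. a \<le> \<bar>S m \<omega>\<bar>}" for n
  have E[measurable]: "E n \<in> sets M" for n
  proof -
    have "{\<omega>\<in>space M. \<exists>m\<in>{..n}. a \<le> \<bar>S m \<omega>\<bar>} \<in> sets M" by measurable
    then show ?thesis by (simp add: E_def Bex_def)
  qed
  have stop_eq: "stop.S n \<omega> = S n \<omega>" if "\<And>j. j < n \<Longrightarrow> \<bar>S j \<omega>\<bar> < a" for n \<omega>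
    unfolding stop.S_def S_def using that by (intro sum.cong) (auto simp: D'_def)
  have frozen: "a \<le> \<bar>stop.S n \<omega>\<bar>" if exc: "\<exists>m\<le>n. a \<le> \<bar>S m \<omega>\<bar>" for n \<omega>
  proof -
    define k where "k = (LEAST m. a \<le> \<bar>S m \<omega>\<bar>)"
    have k: "a \<le> \<bar>S k \<omega>\<bar>" unfolding k_def using exc by (auto intro: LeastI)
    have less: "\<bar>S j \<omega>\<bar> < a" if "j < k" for j
      using not_less_Least[of j "\<lambda>m. a \<le> \<bar>S m \<omega>\<bar>"] that by (auto simp: k_def not_le)
    have kn: "k \<le> n" unfolding k_def using exc by (metis Least_le order_trans)
    have "stop.S n \<omega> = stop.S k \<omega>"
    proof -
      have "(\<Sum>j<n. D' j \<omega>) = (\<Sum>j<k. D' j \<omega>)"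
        using k kn by (intro sum.mono_neutral_right) (auto simp: D'_def not_less)
      then show ?thesis by (simp add: stop.S_def)
    qed
    also have "\<dots> = S k \<omega>" using less by (rule stop_eq)
    finally show ?thesis using k by simp
  qed
  have prob_E: "prob (E n) \<le> C / a\<^sup>2" for n
  proof -
    have "a\<^sup>2 * prob (E n) = (\<integral>\<omega>. a\<^sup>2 * indicator (E n) \<omega> \<partial>M)"
      by simp
    also have "\<dots> \<le> (\<integral>\<omega>. (stop.S n \<omega>)\<^sup>2 \<partial>M)"
    proof (rule integral_mono)
      fix \<omega> assume "\<omega> \<in> space M"
      show "a\<^sup>2 * indicator (E n) \<omega> \<le> (stop.S n \<omega>)\<^sup>2"
      proof (cases "\<omega> \<in> E n")
        case True
        then have "a \<le> \<bar>stop.S n \<omega>\<bar>" using frozen by (simp add: E_def)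
        then show ?thesis using a True power_mono[of a "\<bar>stop.S n \<omega>\<bar>" 2] by simp
      qed simp
    next
      show "integrable M (\<lambda>\<omega>. a\<^sup>2 * indicator (E n) \<omega>)"
        by (intro integrable_mult_right integrable_real_indicator E) (simp add: emeasure_eq_measure)
    qed (use stop.second_moment in auto)
    also have "\<dots> = (\<Sum>k<n. \<integral>\<omega>. (D' k \<omega>)\<^sup>2 \<partial>M)"
      using stop.second_moment by simp
    also have "\<dots> \<le> (\<Sum>k<n. \<integral>\<omega>. (D k \<omega>)\<^sup>2 \<partial>M)"
      by (intro sum_mono integral_mono square_integrable stop.square_integrable) (auto simp: D'_def)
    also have "\<dots> \<le> C" by (rule C)
    finally show ?thesis using a by (simp add: field_simps)
  qed
  have "incseq E"
    by (auto simp: incseq_def E_def) (meson le_trans)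
  then have "(\<lambda>n. prob (E n)) \<longlonglongrightarrow> prob (\<Union>n. E n)"
    by (intro finite_Lim_measure_incseq) auto
  then have "prob (\<Union>n. E n) \<le> C / a\<^sup>2"
    using prob_E by (intro LIMSEQ_le_const2) auto
  moreover have "(\<Union>n. E n) = {\<omega>\<in>space M. \<exists>n. a \<le> \<bar>S n \<omega>\<bar>}"
    by (auto simp: E_def)
  ultimately show ?thesis by simp
qed

lemma AE_partial_sums_bounded:
  assumes summable: "summable (\<lambda>k. \<integral>\<omega>. (D k \<omega>)\<^sup>2 \<partial>M)"
  shows "AE \<omega> in M. \<exists>c. \<forall>n. \<bar>\<Sum>k<n. D k \<omega>\<bar> \<le> c"
proof -
  define C where "C = (\<Sum>k. \<integral>\<omega>. (D k \<omega>)\<^sup>2 \<partial>M)"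
  have C: "(\<Sum>k<n. \<integral>\<omega>. (D k \<omega>)\<^sup>2 \<partial>M) \<le> C" for n
    unfolding C_def by (intro sum_le_suminf summable) auto
  have [measurable]: "S n \<in> borel_measurable M" for n
    by (rule measurable_M[OF measurable_S])
  define N where "N = {\<omega>\<in>space M. \<forall>i. \<exists>n. real (Suc i) \<le> \<bar>S n \<omega>\<bar>}"
  have N: "N \<in> sets M" unfolding N_def by measurable
  have "prob N \<le> C / (real (Suc i))\<^sup>2" for i
  proof -
    have "prob N \<le> prob {\<omega>\<in>space M. \<exists>n. real (Suc i) \<le> \<bar>S n \<omega>\<bar>}"
      by (intro finite_measure_mono) (auto simp: N_def)
    also have "\<dots> \<le> C / (real (Suc i))\<^sup>2"
      using C by (intro maximal_inequality) auto
    finally show ?thesis .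
  qed
  moreover have "(\<lambda>i. C / (real (Suc i))\<^sup>2) \<longlonglongrightarrow> 0"
    by real_asymp
  ultimately have "prob N \<le> 0"
    by (intro LIMSEQ_le_const) auto
  then have "emeasure M N = 0"
    by (simp add: emeasure_eq_measure measure_le_0_iff)
  then have "AE \<omega> in M. \<omega> \<notin> N"
    using N by (intro AE_not_in) auto
  then show ?thesis
    using AE_space
  proof eventually_elim
    case (elim \<omega>)
    then obtain i where "\<And>n. \<bar>S n \<omega>\<bar> < real (Suc i)"
      unfolding N_def by (auto simp: not_le)
    then show ?case by (auto simp: S_def intro!: exI[of _ "real (Suc i)"] less_imp_le)
  qed
qed

end

section \<open>Filtration of an independent sequence\<close>

text \<open>
  The observations are numbered from \<open>1\<close>, and \<open>past n\<close> is generated by the first \<open>n\<close> of them; so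
  \<open>past 0\<close> is trivial, and \<open>\<xi> (Suc n)\<close> is the next observation after \<open>past n\<close>, independent of it.
\<close>

locale iid_sequence = prob_space P for P :: "'w measure" +
  fixes mu :: "'e measure" and \<xi> :: "nat \<Rightarrow> 'w \<Rightarrow> 'e"
  assumes random: "\<And>n. 1 \<le> n \<Longrightarrow> \<xi> n \<in> measurable P mu"
    and indep: "indep_vars (\<lambda>_. mu) \<xi> {1..}"
    and distr: "\<And>n. 1 \<le> n \<Longrightarrow> distr P mu (\<xi> n) = mu"
begin

definition past :: "nat \<Rightarrow> 'w measure"
  where "past n = vimage_algebra (space P) (\<lambda>\<omega>. \<lambda>i\<in>{1..n}. \<xi> i \<omega>) (\<Pi>\<^sub>M i\<in>{1..n}. mu)"

lemma prob_space_mu: "prob_space mu"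
  using prob_space_distr[OF random, of 1] distr[of 1] by simp

lemma measurable_history: "(\<lambda>\<omega>. \<lambda>i\<in>{1..n}. \<xi> i \<omega>) \<in> measurable P (\<Pi>\<^sub>M i\<in>{1..n}. mu)"
  by (intro measurable_restrict random) simp

lemma space_past: "space (past n) = space P"
  by (simp add: past_def)

lemma measurable_history_past:
  "(\<lambda>\<omega>. \<lambda>i\<in>{1..n}. \<xi> i \<omega>) \<in> measurable (past n) (\<Pi>\<^sub>M i\<in>{1..n}. mu)"
  unfolding past_def
  by (rule measurable_vimage_algebra1) (use measurable_space[OF measurable_history] in auto)

lemma measurable_coordinate_past: "1 \<le> i \<Longrightarrow> i \<le> n \<Longrightarrow> \<xi> i \<in> measurable (past n) mu"
  using measurable_compose[OF measurable_history_past measurable_component_singleton[of i "{1..n}"]]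
  by simp

lemma subalgebra_past: "subalgebra P (past n)"
  using measurable_history[of n]
  by (simp add: subalgebra_def space_past past_def sets_image_in_sets sets_vimage_algebra2
    sets_image_in_sets')

lemma past_mono: "sets (past n) \<subseteq> sets (past (Suc n))"
proof -
  have "(\<lambda>\<omega>. \<lambda>i\<in>{1..n}. \<xi> i \<omega>) \<in> measurable (past (Suc n)) (\<Pi>\<^sub>M i\<in>{1..n}. mu)"
    by (intro measurable_restrict measurable_coordinate_past) auto
  then show ?thesis
    unfolding past_def[of n] by (rule sets_image_in_sets[rotated]) (simp add: space_past)
qed

lemma measurable_past_SucI:
  assumes "f \<in> borel_measurable (past n)"
  shows "f \<in> borel_measurable (past (Suc n))"
  by (rule measurable_from_subalg[OF _ assms]) (simp add: subalgebra_def space_past past_mono)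

lemma prob_past_next:
  assumes A: "A \<in> sets (past n)" and B: "B \<in> sets mu"
  shows "prob (A \<inter> (\<xi> (Suc n) -` B \<inter> space P)) = prob A * prob (\<xi> (Suc n) -` B \<inter> space P)"
proof -
  let ?H = "\<lambda>I \<omega>. \<lambda>i\<in>I. \<xi> i \<omega>"
  let ?G = "\<lambda>I. sigma_sets (space P) {?H I -` A \<inter> space P |A. A \<in> sets (\<Pi>\<^sub>M i\<in>I. mu)}"
  have "indep_var (\<Pi>\<^sub>M i\<in>{1..n}. mu) (?H {1..n}) (\<Pi>\<^sub>M i\<in>{Suc n}. mu) (?H {Suc n})"
    by (rule indep_var_restrict[OF indep]) auto
  then have "indep_set (?G {1..n}) (?G {Suc n})"
    unfolding indep_var_eq by simp
  moreover have "A \<in> ?G {1..n}"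
    using A by (simp add: past_def sets_vimage_algebra)
  moreover have "\<xi> (Suc n) -` B \<inter> space P \<in> ?G {Suc n}"
  proof (intro sigma_sets.Basic CollectI exI conjI)
    show "(\<lambda>x. x (Suc n)) -` B \<inter> space (\<Pi>\<^sub>M i\<in>{Suc n}. mu) \<in> sets (\<Pi>\<^sub>M i\<in>{Suc n}. mu)"
      by (rule measurable_sets[OF measurable_component_singleton[of "Suc n" "{Suc n}" "\<lambda>_. mu"] B]) simp
    show "\<xi> (Suc n) -` B \<inter> space P =
        ?H {Suc n} -` ((\<lambda>x. x (Suc n)) -` B \<inter> space (\<Pi>\<^sub>M i\<in>{Suc n}. mu)) \<inter> space P"
      using measurable_space[OF random, of "Suc n"] by (auto simp: space_PiM)
  qed
  ultimately show ?thesis by (rule indep_setD)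
qed

text \<open>
  Independence of \<open>past n\<close> and \<open>\<xi> (Suc n)\<close> as a product formula for the joint law. The value spaces of
  \<open>Z\<close> and \<open>\<xi>\<close> may be different types, so the formula is checked on rectangles, from independence of events.
\<close>

lemma distr_past_next:
  assumes Z: "Z \<in> measurable (past n) N"
  shows "distr P (N \<Otimes>\<^sub>M mu) (\<lambda>\<omega>. (Z \<omega>, \<xi> (Suc n) \<omega>)) = distr P N Z \<Otimes>\<^sub>M mu"
proof -
  note ZM[measurable] = measurable_from_subalg[OF subalgebra_past Z]
    and \<xi>M[measurable] = random[of "Suc n", simplified]
  interpret mu: prob_space mu by (rule prob_space_mu)
  interpret Z: prob_space "distr P N Z" by (rule prob_space_distr) (rule ZM)
  have "distr P N Z \<Otimes>\<^sub>M mu = distr P (N \<Otimes>\<^sub>M mu) (\<lambda>\<omega>. (Z \<omega>, \<xi> (Suc n) \<omega>))"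
  proof (rule pair_measure_eqI)
    show "sigma_finite_measure (distr P N Z)" "sigma_finite_measure mu" ..
    show "sets (distr P N Z \<Otimes>\<^sub>M mu) = sets (distr P (N \<Otimes>\<^sub>M mu) (\<lambda>\<omega>. (Z \<omega>, \<xi> (Suc n) \<omega>)))"
      by (simp cong: sets_pair_measure_cong)
  next
    fix A B assume "A \<in> sets (distr P N Z)" and B: "B \<in> sets mu"
    then have A: "A \<in> sets N" by simp
    have Z_A: "Z -` A \<inter> space P \<in> sets (past n)"
      using measurable_sets[OF Z A] by (simp add: space_past)
    have "emeasure (distr P N Z) A * emeasure mu B
        = emeasure P (Z -` A \<inter> space P) * emeasure P (\<xi> (Suc n) -` B \<inter> space P)"
      using A B distr[of "Suc n"] by (metis One_nat_def Suc_le_mono ZM \<xi>M emeasure_distr le0)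
    also have "\<dots> = emeasure P ((Z -` A \<inter> space P) \<inter> (\<xi> (Suc n) -` B \<inter> space P))"
      unfolding emeasure_eq_measure prob_past_next[OF Z_A B] by (simp add: ennreal_mult)
    also have "(Z -` A \<inter> space P) \<inter> (\<xi> (Suc n) -` B \<inter> space P)
        = (\<lambda>\<omega>. (Z \<omega>, \<xi> (Suc n) \<omega>)) -` (A \<times> B) \<inter> space P"
      by auto
    also have "emeasure P \<dots> = emeasure (distr P (N \<Otimes>\<^sub>M mu) (\<lambda>\<omega>. (Z \<omega>, \<xi> (Suc n) \<omega>))) (A \<times> B)"
      using A B by (subst emeasure_distr) auto
    finally show "emeasure (distr P N Z) A * emeasure mu B
        = emeasure (distr P (N \<Otimes>\<^sub>M mu) (\<lambda>\<omega>. (Z \<omega>, \<xi> (Suc n) \<omega>))) (A \<times> B)" .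
  qed
  then show ?thesis ..
qed

lemma nn_integral_past_next:
  assumes Z: "Z \<in> measurable (past n) N" and f[measurable]: "f \<in> borel_measurable (N \<Otimes>\<^sub>M mu)"
  shows "(\<integral>\<^sup>+\<omega>. f (Z \<omega>, \<xi> (Suc n) \<omega>) \<partial>P) = (\<integral>\<^sup>+\<omega>. \<integral>\<^sup>+s. f (Z \<omega>, s) \<partial>mu \<partial>P)"
proof -
  interpret mu: prob_space mu by (rule prob_space_mu)
  note [measurable] = measurable_from_subalg[OF subalgebra_past Z] random[of "Suc n", simplified]
  have "(\<integral>\<^sup>+\<omega>. f (Z \<omega>, \<xi> (Suc n) \<omega>) \<partial>P)
      = (\<integral>\<^sup>+p. f p \<partial>distr P (N \<Otimes>\<^sub>M mu) (\<lambda>\<omega>. (Z \<omega>, \<xi> (Suc n) \<omega>)))"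
    by (subst nn_integral_distr) auto
  also have "\<dots> = (\<integral>\<^sup>+z. \<integral>\<^sup>+s. f (z, s) \<partial>mu \<partial>distr P N Z)"
    unfolding distr_past_next[OF Z] by (subst mu.nn_integral_fst[symmetric]) auto
  also have "\<dots> = (\<integral>\<^sup>+\<omega>. \<integral>\<^sup>+s. f (Z \<omega>, s) \<partial>mu \<partial>P)"
    by (subst nn_integral_distr) auto
  finally show ?thesis .
qed

text \<open>
  The substitute for ``conditional expectation given the past is zero'': a function of past and next
  observation that is centred in the latter has mean zero. Letting \<open>Z\<close> contain a
  test function yields the orthogonality required of martingale differences.
\<close>

lemma integral_past_next_eq_0:
  fixes f :: "'z \<times> 'e \<Rightarrow> real"
  assumes Z: "Z \<in> measurable (past n) N" and f[measurable]: "f \<in> borel_measurable (N \<Otimes>\<^sub>M mu)"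
    and int: "integrable P (\<lambda>\<omega>. f (Z \<omega>, \<xi> (Suc n) \<omega>))"
    and 0: "\<And>z. z \<in> space N \<Longrightarrow> (\<integral>s. f (z, s) \<partial>mu) = 0"
  shows "(\<integral>\<omega>. f (Z \<omega>, \<xi> (Suc n) \<omega>) \<partial>P) = 0"
proof -
  interpret mu: prob_space mu by (rule prob_space_mu)
  note ZM[measurable] = measurable_from_subalg[OF subalgebra_past Z] and [measurable] = random[of "Suc n", simplified]
  interpret Z: prob_space "distr P N Z" by (rule prob_space_distr) (rule ZM)
  interpret pair_sigma_finite "distr P N Z" mu ..
  have int': "integrable (distr P N Z \<Otimes>\<^sub>M mu) f"
    unfolding distr_past_next[OF Z, symmetric] using int by (subst integrable_distr_eq) auto
  have "(\<integral>\<omega>. f (Z \<omega>, \<xi> (Suc n) \<omega>) \<partial>P)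
      = (\<integral>p. f p \<partial>distr P (N \<Otimes>\<^sub>M mu) (\<lambda>\<omega>. (Z \<omega>, \<xi> (Suc n) \<omega>)))"
    by (subst integral_distr) auto
  also have "\<dots> = (\<integral>z. \<integral>s. f (z, s) \<partial>mu \<partial>distr P N Z)"
    unfolding distr_past_next[OF Z] using integral_fst'[OF int'] by simp
  also have "\<dots> = 0"
    by (subst Bochner_Integration.integral_cong[where g="\<lambda>_. 0", OF refl]) (auto simp: 0)
  finally show ?thesis .
qed

lemma distr_transfer:
  fixes f :: "'e \<Rightarrow> 'b::{banach, second_countable_topology}"
  assumes int: "integrable mu f"
  shows "integrable P (\<lambda>\<omega>. f (\<xi> (Suc n) \<omega>))" "(\<integral>\<omega>. f (\<xi> (Suc n) \<omega>) \<partial>P) = (\<integral>s. f s \<partial>mu)"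
proof -
  note [measurable] = random[of "Suc n", simplified] borel_measurable_integrable[OF int]
  show "integrable P (\<lambda>\<omega>. f (\<xi> (Suc n) \<omega>))"
    using int integrable_distr_eq[of "\<xi> (Suc n)" P mu f] distr[of "Suc n"] by simp
  show "(\<integral>\<omega>. f (\<xi> (Suc n) \<omega>) \<partial>P) = (\<integral>s. f s \<partial>mu)"
    using integral_distr[of "\<xi> (Suc n)" P mu f] distr[of "Suc n"] by simp
qed

lemma AE_next:
  assumes "AE s in mu. Q s"
  shows "AE \<omega> in P. Q (\<xi> (Suc n) \<omega>)"
proof -
  have "\<xi> (Suc n) \<in> measurable P mu" by (rule random) simp
  moreover have "AE s in distr P mu (\<xi> (Suc n)). Q s" using assms by (subst distr) simp_all
  ultimately show ?thesis by (rule AE_distrD)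
qed

lemma product_past_next:
  fixes f :: "'e \<Rightarrow> real" and Z :: "'w \<Rightarrow> real"
  assumes Z: "Z \<in> borel_measurable (past n)" "integrable P Z" "\<And>\<omega>. 0 \<le> Z \<omega>"
    and f: "integrable mu f" "\<And>s. 0 \<le> f s"
  shows "integrable P (\<lambda>\<omega>. Z \<omega> * f (\<xi> (Suc n) \<omega>))"
    "(\<integral>\<omega>. Z \<omega> * f (\<xi> (Suc n) \<omega>) \<partial>P) = (\<integral>\<omega>. Z \<omega> \<partial>P) * (\<integral>s. f s \<partial>mu)"
proof -
  note [measurable] = borel_measurable_integrable[OF Z(2)] borel_measurable_integrable[OF f(1)]
    random[of "Suc n", simplified]
  have "(\<integral>\<^sup>+\<omega>. ennreal (Z \<omega> * f (\<xi> (Suc n) \<omega>)) \<partial>P) = (\<integral>\<^sup>+\<omega>. \<integral>\<^sup>+s. ennreal (Z \<omega>) * ennreal (f s) \<partial>mu \<partial>P)"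
    using nn_integral_past_next[OF Z(1), of "\<lambda>p. ennreal (fst p) * ennreal (f (snd p))"] Z(3) f(2)
    by (simp add: ennreal_mult)
  also have "\<dots> = (\<integral>\<^sup>+\<omega>. ennreal (Z \<omega>) \<partial>P) * (\<integral>\<^sup>+s. ennreal (f s) \<partial>mu)"
    by (simp add: nn_integral_cmult nn_integral_multc)
  also have "\<dots> = ennreal ((\<integral>\<omega>. Z \<omega> \<partial>P) * (\<integral>s. f s \<partial>mu))"
    using Z f by (simp add: nn_integral_eq_integral ennreal_mult)
  finally have "integrable P (\<lambda>\<omega>. Z \<omega> * f (\<xi> (Suc n) \<omega>)) \<and>
      (\<integral>\<omega>. Z \<omega> * f (\<xi> (Suc n) \<omega>) \<partial>P) = (\<integral>\<omega>. Z \<omega> \<partial>P) * (\<integral>s. f s \<partial>mu)"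
    using Z f by (subst (asm) nn_integral_eq_integrable) (auto intro!: mult_nonneg_nonneg integral_nonneg)
  then show "integrable P (\<lambda>\<omega>. Z \<omega> * f (\<xi> (Suc n) \<omega>))"
    "(\<integral>\<omega>. Z \<omega> * f (\<xi> (Suc n) \<omega>) \<partial>P) = (\<integral>\<omega>. Z \<omega> \<partial>P) * (\<integral>s. f s \<partial>mu)"
    by auto
qed

end

section \<open>Weighted averages\<close>

locale divergent_weights =
  fixes lam :: "nat \<Rightarrow> real"
  assumes lam_pos: "\<And>n. 0 < lam n"
    and lam_sum: "filterlim (\<lambda>n. \<Sum>k<n. lam k) at_top sequentially"
begin

definition total :: "nat \<Rightarrow> real" where "total n = (\<Sum>k=1..n. lam k)"

definition avg :: "nat \<Rightarrow> (nat \<Rightarrow> real) \<Rightarrow> real"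
  where "avg n g = (\<Sum>k=1..n. lam k * g k) / total n"

lemma sum_from_1: "(\<Sum>k=1..n. g k) = (\<Sum>k<Suc n. g k) - g 0" for g :: "nat \<Rightarrow> real"
  by (induction n) auto

lemma filterlim_total: "filterlim total at_top sequentially"
proof -
  have "filterlim (\<lambda>n. - lam 0 + (\<Sum>k<Suc n. lam k)) at_top sequentially"
    by (rule filterlim_tendsto_add_at_top[OF tendsto_const filterlim_compose[OF lam_sum filterlim_Suc]])
  moreover have "(\<lambda>n. - lam 0 + (\<Sum>k<Suc n. lam k)) = total"
    unfolding total_def sum_from_1 by (simp del: sum.lessThan_Suc)
  ultimately show ?thesis by simp
qed

lemma total_pos: "1 \<le> n \<Longrightarrow> 0 < total n"
  unfolding total_def using lam_pos by (intro sum_pos) auto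

lemma avg_mono: "1 \<le> n \<Longrightarrow> (\<And>k. g k \<le> g' k) \<Longrightarrow> avg n g \<le> avg n g'"
  unfolding avg_def using total_pos[of n] lam_pos
  by (intro divide_right_mono sum_mono mult_left_mono) (auto intro: less_imp_le)

lemma avg_add: "avg n (\<lambda>k. g k + g' k) = avg n g + avg n g'"
  by (simp add: avg_def sum.distrib distrib_left add_divide_distrib)

lemma avg_mult: "avg n (\<lambda>k. r * g k) = r * avg n g"
  by (simp add: avg_def sum_distrib_left mult.left_commute)

lemma avg_const: "1 \<le> n \<Longrightarrow> avg n (\<lambda>_. r) = r"
  using total_pos[of n] by (simp add: avg_def total_def flip: sum_distrib_right)

text \<open>
  The averages start at \<open>k = 1\<close> while the bounds on the iteration come as sums from \<open>k = 0\<close>; the missing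
  term is a constant and disappears after division.
\<close>

lemma avg_tendsto_0:
  assumes "\<And>n. \<bar>\<Sum>k<n. lam k * g k\<bar> \<le> r"
  shows "(\<lambda>n. avg n g) \<longlonglongrightarrow> 0"
proof (rule Lim_null_comparison)
  show "eventually (\<lambda>n. norm (avg n g) \<le> (r + \<bar>lam 0 * g 0\<bar>) / total n) sequentially"
  proof (rule eventually_sequentiallyI[of 1])
    fix n :: nat assume n: "1 \<le> n"
    have "\<bar>\<Sum>k=1..n. lam k * g k\<bar> \<le> r + \<bar>lam 0 * g 0\<bar>"
      unfolding sum_from_1 using assms[of "Suc n"] by linarith
    then show "norm (avg n g) \<le> (r + \<bar>lam 0 * g 0\<bar>) / total n"
      using total_pos[OF n] by (simp add: avg_def divide_right_mono)
  qed
  show "(\<lambda>n. (r + \<bar>lam 0 * g 0\<bar>) / total n) \<longlonglongrightarrow> 0"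
    by (rule tendsto_divide_0[OF tendsto_const filterlim_at_top_imp_at_infinity[OF filterlim_total]])
qed

end

section \<open>The stochastic proximal point iteration\<close>

text \<open>
  The situation once \<open>A\<close> has been repaired on a null set of \<open>s\<close>; \<open>zs\<close> is a point of \<open>Z\<^sub>A(2)\<close> with its centred square
  integrable selection \<open>\<phi>\<close>.
\<close>

locale stochastic_proximal_point = iid_sequence P mu \<xi> + divergent_weights lam
  for P :: "'w measure" and mu :: "'e measure" and \<xi> :: "nat \<Rightarrow> 'w \<Rightarrow> 'e" and lam :: "nat \<Rightarrow> real" +
  fixes A :: "'e \<Rightarrow> 'h \<Rightarrow> 'h::{real_inner, banach, second_countable_topology} set"
    and x0 :: 'h and zs :: 'h and \<phi> :: "'e \<Rightarrow> 'h"
  assumes maximal: "\<And>s. maximal_monotone (A s)"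
    and resolvent_measurable: "\<And>r y. 0 < r \<Longrightarrow> (\<lambda>s. resolvent A r s y) \<in> borel_measurable mu"
    and lam_sq: "summable (\<lambda>n. (lam n)\<^sup>2)"
    and \<phi>_measurable[measurable]: "\<phi> \<in> borel_measurable mu"
    and \<phi>_sel: "AE s in mu. \<phi> s \<in> A s zs"
    and \<phi>_sq: "integrable mu (\<lambda>s. (norm (\<phi> s))\<^sup>2)"
    and \<phi>_mean: "(\<integral>s. \<phi> s \<partial>mu) = 0"
begin

sublocale mu: prob_space mu by (rule prob_space_mu)

primrec X :: "nat \<Rightarrow> 'w \<Rightarrow> 'h" where
  "X 0 \<omega> = x0"
| "X (Suc n) \<omega> = resolvent A (lam n) (\<xi> (Suc n) \<omega>) (X n \<omega>)"

abbreviation Y :: "nat \<Rightarrow> 'e \<Rightarrow> 'h \<Rightarrow> 'h" where "Y n \<equiv> yosida A (lam n)"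

text \<open>
  \<open>y n\<close> is the actual step direction, and \<open>h n (X n)\<close> its conditional mean given the past.
\<close>

definition y :: "nat \<Rightarrow> 'w \<Rightarrow> 'h" where "y n \<omega> = Y n (\<xi> (Suc n) \<omega>) (X n \<omega>)"

definition h :: "nat \<Rightarrow> 'h \<Rightarrow> 'h" where "h n x = (\<integral>s. Y n s x \<partial>mu)"

lemma X_Suc_eq: "X (Suc n) \<omega> = X n \<omega> - lam n *\<^sub>R y n \<omega>"
  using yosida_eq[OF lam_pos[of n], of "X n \<omega>" A "\<xi> (Suc n) \<omega>"] by (simp add: y_def algebra_simps)

lemma measurable_resolvent[measurable]:
  "(\<lambda>p. resolvent A (lam n) (fst p) (snd p)) \<in> borel_measurable (mu \<Otimes>\<^sub>M borel)"
proof -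
  have "continuous_on UNIV (resolvent A (lam n) s)" for s
    unfolding continuous_on_iff
    using resolvent_nonexpansive[of A s "lam n", OF maximal lam_pos]
    by (metis dist_norm order_le_less_trans)
  then have "(\<lambda>(s, x). resolvent A (lam n) s x) \<in> borel_measurable (mu \<Otimes>\<^sub>M borel)"
    by (intro borel_measurable_Caratheodory resolvent_measurable lam_pos)
  then show ?thesis by (simp add: case_prod_beta')
qed

lemma measurable_Y[measurable]:
  assumes [measurable]: "f \<in> measurable N mu" "g \<in> borel_measurable N"
  shows "(\<lambda>p. Y n (f p) (g p)) \<in> borel_measurable N"
proof -
  have "(\<lambda>p. resolvent A (lam n) (f p) (g p)) \<in> borel_measurable N"
    using measurable_compose[OF _ measurable_resolvent, of "\<lambda>p. (f p, g p)" N n] by simp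
  then show ?thesis unfolding yosida_def by measurable
qed

lemma measurable_h[measurable]: "h n \<in> borel_measurable borel"
  unfolding h_def by measurable

lemma X_past: "X n \<in> borel_measurable (past n)"
proof (induction n)
  case (Suc n)
  have [measurable]: "X n \<in> borel_measurable (past (Suc n))"
    using Suc by (rule measurable_past_SucI)
  have [measurable]: "\<xi> (Suc n) \<in> measurable (past (Suc n)) mu"
    by (rule measurable_coordinate_past) auto
  show ?case
    using measurable_compose[OF _ measurable_resolvent, of "\<lambda>\<omega>. (\<xi> (Suc n) \<omega>, X n \<omega>)" "past (Suc n)" n]
    by simp
qed simp

lemma X_measurable[measurable]: "X n \<in> borel_measurable P"
  by (rule measurable_from_subalg[OF subalgebra_past X_past])

lemma \<xi>_measurable[measurable]: "\<xi> (Suc n) \<in> measurable P mu"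
  by (rule random) simp

lemma y_measurable[measurable]: "y n \<in> borel_measurable P"
  unfolding y_def by measurable

text \<open>
  At \<open>zs\<close> the Yosida approximation is dominated by \<open>\<phi>\<close>, and it is Lipschitz in \<open>x\<close> with a constant that is
  independent of \<open>s\<close>.
\<close>

lemma Y_square_integrable: "integrable mu (\<lambda>s. (norm (Y n s x))\<^sup>2)"
proof (rule Bochner_Integration.integrable_bound)
  let ?c = "2 * norm (x - zs) / lam n"
  show "integrable mu (\<lambda>s. 2 * (norm (\<phi> s))\<^sup>2 + 2 * ?c\<^sup>2)"
    using \<phi>_sq by auto
  show "AE s in mu. norm ((norm (Y n s x))\<^sup>2) \<le> norm (2 * (norm (\<phi> s))\<^sup>2 + 2 * ?c\<^sup>2)"
    using \<phi>_sel
  proof eventually_elim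
    case (elim s)
    have "norm (Y n s x) \<le> norm (Y n s zs) + norm (Y n s x - Y n s zs)"
      by (metis add_diff_cancel_left' diff_add_cancel norm_triangle_ineq)
    also have "\<dots> \<le> norm (\<phi> s) + ?c"
      using norm_yosida_le[of A s "lam n" "\<phi> s" zs, OF maximal lam_pos elim]
        norm_yosida_diff_le[of A s "lam n" x zs, OF maximal lam_pos] by simp
    finally have "(norm (Y n s x))\<^sup>2 \<le> (norm (\<phi> s) + ?c)\<^sup>2"
      by (intro power_mono) auto
    also have "\<dots> \<le> 2 * (norm (\<phi> s))\<^sup>2 + 2 * ?c\<^sup>2"
      using sum_squares_bound[of "norm (\<phi> s)" ?c] unfolding power2_sum by linarith
    finally show ?case by simp
  qed
qed measurable

lemma Y_integrable: "integrable mu (\<lambda>s. Y n s x)"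
  by (rule mu.integrable_if_square_integrable[OF _ Y_square_integrable]) measurable

definition V :: "nat \<Rightarrow> 'w \<Rightarrow> real" where "V n \<omega> = (norm (X n \<omega> - zs))\<^sup>2"

definition noise :: "nat \<Rightarrow> 'w \<Rightarrow> real"
  where "noise n \<omega> = lam n * inner (\<phi> (\<xi> (Suc n) \<omega>)) (X n \<omega> - zs)"

definition \<phi>_moment :: real where "\<phi>_moment = (\<integral>s. (norm (\<phi> s))\<^sup>2 \<partial>mu)"

lemma V_measurable[measurable]: "V n \<in> borel_measurable P"
  unfolding V_def by measurable

lemma noise_measurable[measurable]: "noise n \<in> borel_measurable P"
  unfolding noise_def by measurable

lemma AE_descent:
  "AE \<omega> in P. \<forall>n. V (Suc n) \<omega> + (lam n)\<^sup>2 * (norm (y n \<omega>))\<^sup>2 / 2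
    \<le> V n \<omega> - 2 * noise n \<omega> + 2 * ((lam n)\<^sup>2 * (norm (\<phi> (\<xi> (Suc n) \<omega>)))\<^sup>2)"
  unfolding AE_all_countable
proof
  fix n
  show "AE \<omega> in P. V (Suc n) \<omega> + (lam n)\<^sup>2 * (norm (y n \<omega>))\<^sup>2 / 2
    \<le> V n \<omega> - 2 * noise n \<omega> + 2 * ((lam n)\<^sup>2 * (norm (\<phi> (\<xi> (Suc n) \<omega>)))\<^sup>2)"
    using AE_next[OF \<phi>_sel, of n]
  proof eventually_elim
    case (elim \<omega>)
    show ?case
      using resolvent_descent[of A "\<xi> (Suc n) \<omega>" "lam n" _ zs "X n \<omega>", OF maximal lam_pos elim]
      by (simp add: V_def noise_def y_def)
  qed
qed

lemma noise_square:
  assumes "integrable P (V n)"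
  shows "integrable P (\<lambda>\<omega>. (noise n \<omega>)\<^sup>2)"
    "(\<integral>\<omega>. (noise n \<omega>)\<^sup>2 \<partial>P) \<le> (lam n)\<^sup>2 * ((\<integral>\<omega>. V n \<omega> \<partial>P) * \<phi>_moment)"
proof -
  let ?B = "\<lambda>\<omega>. (lam n)\<^sup>2 * (V n \<omega> * (norm (\<phi> (\<xi> (Suc n) \<omega>)))\<^sup>2)"
  have le: "(noise n \<omega>)\<^sup>2 \<le> ?B \<omega>" for \<omega>
  proof -
    have "(inner (\<phi> (\<xi> (Suc n) \<omega>)) (X n \<omega> - zs))\<^sup>2 \<le> V n \<omega> * (norm (\<phi> (\<xi> (Suc n) \<omega>)))\<^sup>2"
      using Cauchy_Schwarz_ineq[of "\<phi> (\<xi> (Suc n) \<omega>)" "X n \<omega> - zs"]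
      by (simp add: V_def power2_norm_eq_inner mult.commute)
    then show ?thesis
      unfolding noise_def power_mult_distrib by (intro mult_left_mono) auto
  qed
  have V: "V n \<in> borel_measurable (past n)"
    using X_past[of n] unfolding V_def by measurable
  have int: "integrable P ?B" and eq: "(\<integral>\<omega>. ?B \<omega> \<partial>P) = (lam n)\<^sup>2 * ((\<integral>\<omega>. V n \<omega> \<partial>P) * \<phi>_moment)"
    using product_past_next[OF V assms _ \<phi>_sq] by (auto simp: V_def \<phi>_moment_def)
  show sq: "integrable P (\<lambda>\<omega>. (noise n \<omega>)\<^sup>2)"
    by (rule Bochner_Integration.integrable_bound[OF int]) (use order_trans[OF le abs_ge_self] in auto)
  have "(\<integral>\<omega>. (noise n \<omega>)\<^sup>2 \<partial>P) \<le> (\<integral>\<omega>. ?B \<omega> \<partial>P)"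
    by (intro integral_mono sq int le)
  also note eq
  finally show "(\<integral>\<omega>. (noise n \<omega>)\<^sup>2 \<partial>P) \<le> (lam n)\<^sup>2 * ((\<integral>\<omega>. V n \<omega> \<partial>P) * \<phi>_moment)"
    .
qed

lemma noise_orthogonal:
  assumes V: "integrable P (V n)"
    and g: "g \<in> borel_measurable (past n)" "integrable P (\<lambda>\<omega>. (g \<omega>)\<^sup>2)"
  shows "(\<integral>\<omega>. noise n \<omega> * g \<omega> \<partial>P) = 0"
proof -
  let ?f = "\<lambda>p. lam n * inner (\<phi> (snd p)) (fst (fst p) - zs) * snd (fst p)"
  have "(\<integral>\<omega>. ?f ((X n \<omega>, g \<omega>), \<xi> (Suc n) \<omega>) \<partial>P) = 0"
  proof (rule integral_past_next_eq_0)
    show "(\<lambda>\<omega>. (X n \<omega>, g \<omega>)) \<in> measurable (past n) (borel \<Otimes>\<^sub>M borel)"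
      using X_past[of n] g by measurable
    have "integrable P (\<lambda>\<omega>. noise n \<omega> * g \<omega>)"
      using g measurable_from_subalg[OF subalgebra_past g(1)] noise_square[OF V]
      by (intro integrable_mult_of_squares) auto
    then show "integrable P (\<lambda>\<omega>. ?f ((X n \<omega>, g \<omega>), \<xi> (Suc n) \<omega>))"
      by (simp add: noise_def)
    show "(\<integral>s. ?f (z, s) \<partial>mu) = 0" for z
    proof -
      have "(\<integral>s. inner (\<phi> s) (fst z - zs) \<partial>mu) = inner (\<integral>s. \<phi> s \<partial>mu) (fst z - zs)"
        using mu.integrable_if_square_integrable[OF \<phi>_measurable \<phi>_sq] by simp
      then show ?thesis by (simp add: \<phi>_mean)
    qed
  qed measurable
  then show ?thesis by (simp add: noise_def)
qed

text \<open>
  The expectation of the descent inequality, in which the noise vanishes. Integrability of \<open>V (Suc n)\<close> and of \<open>|y n|\<^sup>2\<close> is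
  part of the conclusion because it comes from the same inequality, which makes the induction on \<open>n\<close> possible.
\<close>

lemma energy_step:
  assumes V: "integrable P (V n)"
  shows "integrable P (V (Suc n)) \<and> integrable P (\<lambda>\<omega>. (norm (y n \<omega>))\<^sup>2) \<and>
    (\<integral>\<omega>. V (Suc n) \<omega> \<partial>P) + (lam n)\<^sup>2 * (\<integral>\<omega>. (norm (y n \<omega>))\<^sup>2 \<partial>P) / 2
      \<le> (\<integral>\<omega>. V n \<omega> \<partial>P) + 2 * ((lam n)\<^sup>2 * \<phi>_moment)"
proof -
  let ?B = "\<lambda>\<omega>. V n \<omega> - 2 * noise n \<omega> + 2 * ((lam n)\<^sup>2 * (norm (\<phi> (\<xi> (Suc n) \<omega>)))\<^sup>2)"
  have noise: "integrable P (noise n)"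
    using noise_square(1)[OF V] by (intro integrable_if_square_integrable[of "noise n"]) auto
  have B: "integrable P ?B"
    using V noise distr_transfer(1)[OF \<phi>_sq] by auto
  have V0: "0 \<le> V k \<omega>" for k \<omega> by (simp add: V_def)
  have y0: "0 \<le> (lam n)\<^sup>2 * (norm (y n \<omega>))\<^sup>2 / 2" for \<omega> by simp
  have descent: "AE \<omega> in P. V (Suc n) \<omega> + (lam n)\<^sup>2 * (norm (y n \<omega>))\<^sup>2 / 2 \<le> ?B \<omega>"
    using AE_descent by eventually_elim auto
  have intV: "integrable P (V (Suc n))"
  proof (rule Bochner_Integration.integrable_bound[OF B])
    show "AE \<omega> in P. norm (V (Suc n) \<omega>) \<le> norm (?B \<omega>)"
      using descent
    proof eventually_elim
      case (elim \<omega>)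
      then show ?case
        using V0[of "Suc n" \<omega>] y0[of \<omega>] unfolding real_norm_def by linarith
    qed
  qed measurable
  have "integrable P (\<lambda>\<omega>. (lam n)\<^sup>2 * (norm (y n \<omega>))\<^sup>2 / 2)"
  proof (rule Bochner_Integration.integrable_bound[OF B])
    show "AE \<omega> in P. norm ((lam n)\<^sup>2 * (norm (y n \<omega>))\<^sup>2 / 2) \<le> norm (?B \<omega>)"
      using descent
    proof eventually_elim
      case (elim \<omega>)
      then show ?case
        using V0[of "Suc n" \<omega>] y0[of \<omega>] unfolding real_norm_def by linarith
    qed
  qed measurable
  then have inty: "integrable P (\<lambda>\<omega>. (norm (y n \<omega>))\<^sup>2)"
    using integrable_mult_right[of "2 / (lam n)\<^sup>2"] lam_pos[of n] by (force simp: field_simps)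
  have "(\<integral>\<omega>. V (Suc n) \<omega> + (lam n)\<^sup>2 * (norm (y n \<omega>))\<^sup>2 / 2 \<partial>P) \<le> (\<integral>\<omega>. ?B \<omega> \<partial>P)"
    using intV inty by (intro integral_mono_AE B descent) auto
  also have "(\<integral>\<omega>. ?B \<omega> \<partial>P) = (\<integral>\<omega>. V n \<omega> \<partial>P) - 2 * (\<integral>\<omega>. noise n \<omega> \<partial>P) + 2 * ((lam n)\<^sup>2 * \<phi>_moment)"
    using V noise distr_transfer[OF \<phi>_sq, of n] by (simp add: \<phi>_moment_def)
  also have "(\<integral>\<omega>. noise n \<omega> \<partial>P) = 0"
    using noise_orthogonal[OF V, of "\<lambda>_. 1"] by simp
  finally show ?thesis
    using intV inty by simp
qed

lemma V_integrable: "integrable P (V n)"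
proof (induction n)
  case 0
  show ?case by (simp add: V_def)
next
  case (Suc n)
  then show ?case using energy_step by blast
qed

lemma y_square_integrable: "integrable P (\<lambda>\<omega>. (norm (y n \<omega>))\<^sup>2)"
  using energy_step[OF V_integrable] by blast

lemma \<phi>_moment_nonneg: "0 \<le> \<phi>_moment"
  unfolding \<phi>_moment_def by simp

lemma energy_bound:
  "(\<integral>\<omega>. V n \<omega> \<partial>P) + (\<Sum>k<n. (lam k)\<^sup>2 * (\<integral>\<omega>. (norm (y k \<omega>))\<^sup>2 \<partial>P) / 2)
    \<le> (norm (x0 - zs))\<^sup>2 + 2 * \<phi>_moment * (\<Sum>k. (lam k)\<^sup>2)"
proof -
  have "(\<integral>\<omega>. V n \<omega> \<partial>P) + (\<Sum>k<n. (lam k)\<^sup>2 * (\<integral>\<omega>. (norm (y k \<omega>))\<^sup>2 \<partial>P) / 2)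
    \<le> (norm (x0 - zs))\<^sup>2 + 2 * \<phi>_moment * (\<Sum>k<n. (lam k)\<^sup>2)"
  proof (induction n)
    case 0
    show ?case by (simp add: V_def prob_space)
  next
    case (Suc n)
    then show ?case
      using energy_step[OF V_integrable, of n] by (simp add: algebra_simps)
  qed
  also have "\<dots> \<le> (norm (x0 - zs))\<^sup>2 + 2 * \<phi>_moment * (\<Sum>k. (lam k)\<^sup>2)"
    using \<phi>_moment_nonneg by (intro add_left_mono mult_left_mono sum_le_suminf lam_sq) auto
  finally show ?thesis .
qed

lemma summable_y: "summable (\<lambda>k. (lam k)\<^sup>2 * (\<integral>\<omega>. (norm (y k \<omega>))\<^sup>2 \<partial>P))"
proof -
  have "(\<Sum>k<n. (lam k)\<^sup>2 * (\<integral>\<omega>. (norm (y k \<omega>))\<^sup>2 \<partial>P) / 2)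
      \<le> (norm (x0 - zs))\<^sup>2 + 2 * \<phi>_moment * (\<Sum>k. (lam k)\<^sup>2)" for n
  proof -
    have "0 \<le> (\<integral>\<omega>. V n \<omega> \<partial>P)" by (simp add: V_def)
    then show ?thesis using energy_bound[of n] by linarith
  qed
  then have "summable (\<lambda>k. (lam k)\<^sup>2 * (\<integral>\<omega>. (norm (y k \<omega>))\<^sup>2 \<partial>P) / 2)"
    by (intro summableI_nonneg_bounded) auto
  then show ?thesis
    using summable_mult[of _ 2] by simp
qed

lemma AE_summable_y: "AE \<omega> in P. summable (\<lambda>k. (lam k)\<^sup>2 * (norm (y k \<omega>))\<^sup>2)"
  by (rule AE_summable_of_summable_integral) (use y_square_integrable summable_y in auto)

lemma AE_summable_\<phi>: "AE \<omega> in P. summable (\<lambda>k. (lam k)\<^sup>2 * (norm (\<phi> (\<xi> (Suc k) \<omega>)))\<^sup>2)"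
proof (rule AE_summable_of_summable_integral)
  show "integrable P (\<lambda>\<omega>. (lam k)\<^sup>2 * (norm (\<phi> (\<xi> (Suc k) \<omega>)))\<^sup>2)" for k
    by (intro integrable_mult_right distr_transfer(1)[OF \<phi>_sq])
  show "summable (\<lambda>k. \<integral>\<omega>. (lam k)\<^sup>2 * (norm (\<phi> (\<xi> (Suc k) \<omega>)))\<^sup>2 \<partial>P)"
    using summable_mult2[OF lam_sq] by (simp add: distr_transfer(2)[OF \<phi>_sq])
qed simp

text \<open>
  Since \<open>\<xi> (Suc n)\<close> is independent of \<open>X n\<close>, the second moment of \<open>noise n\<close> is at most \<open>(lam n)\<^sup>2\<close> times
  a constant, by the uniform bound on the mean of \<open>V n\<close>.
\<close>

lemma AE_noise_bounded: "AE \<omega> in P. \<exists>c. \<forall>n. \<bar>\<Sum>k<n. noise k \<omega>\<bar> \<le> c"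
proof -
  interpret noise: square_integrable_martingale_differences P past noise
  proof
    show "noise n \<in> borel_measurable (past (Suc n))" for n
      using measurable_past_SucI[OF X_past, of n] measurable_coordinate_past[of "Suc n" "Suc n"]
      unfolding noise_def by measurable
  qed (use subalgebra_past past_mono noise_square(1)[OF V_integrable] noise_orthogonal[OF V_integrable] in auto)
  let ?C = "(norm (x0 - zs))\<^sup>2 + 2 * \<phi>_moment * (\<Sum>k. (lam k)\<^sup>2)"
  have V_le: "(\<integral>\<omega>. V n \<omega> \<partial>P) \<le> ?C" for n
  proof -
    have "0 \<le> (\<Sum>k<n. (lam k)\<^sup>2 * (\<integral>\<omega>. (norm (y k \<omega>))\<^sup>2 \<partial>P) / 2)"
      by (intro sum_nonneg) auto
    then show ?thesis using energy_bound[of n] by linarith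
  qed
  have "norm (\<integral>\<omega>. (noise n \<omega>)\<^sup>2 \<partial>P) \<le> (lam n)\<^sup>2 * (?C * \<phi>_moment)" for n
  proof -
    have "(\<integral>\<omega>. (noise n \<omega>)\<^sup>2 \<partial>P) \<le> (lam n)\<^sup>2 * ((\<integral>\<omega>. V n \<omega> \<partial>P) * \<phi>_moment)"
      by (rule noise_square(2)[OF V_integrable])
    also have "\<dots> \<le> (lam n)\<^sup>2 * (?C * \<phi>_moment)"
      by (intro mult_left_mono mult_right_mono V_le \<phi>_moment_nonneg) auto
    finally show ?thesis by simp
  qed
  then have "summable (\<lambda>n. \<integral>\<omega>. (noise n \<omega>)\<^sup>2 \<partial>P)"
    by (intro summable_comparison_test'[OF summable_mult2[OF lam_sq, of "?C * \<phi>_moment"], of 0])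
  then show ?thesis by (rule noise.AE_partial_sums_bounded)
qed

text \<open>Sum the pathwise descent inequality; the noise and the quadratic errors have bounded partial sums.\<close>

lemma AE_X_bounded: "AE \<omega> in P. \<exists>c. \<forall>n. norm (X n \<omega>) \<le> c"
  using AE_noise_bounded AE_summable_\<phi> AE_descent
proof eventually_elim
  case (elim \<omega>)
  obtain c where c: "\<And>n. \<bar>\<Sum>k<n. noise k \<omega>\<bar> \<le> c"
    using elim(1) by blast
  let ?f = "\<lambda>k. (lam k)\<^sup>2 * (norm (\<phi> (\<xi> (Suc k) \<omega>)))\<^sup>2"
  have V: "V n \<omega> \<le> (norm (x0 - zs))\<^sup>2 - 2 * (\<Sum>k<n. noise k \<omega>) + 2 * (\<Sum>k<n. ?f k)" for n
  proof (induction n)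
    case 0
    show ?case by (simp add: V_def)
  next
    case (Suc n)
    have "0 \<le> (lam n)\<^sup>2 * (norm (y n \<omega>))\<^sup>2 / 2" by simp
    with Suc elim(3)[rule_format, of n] show ?case
      unfolding sum.lessThan_Suc distrib_left by linarith
  qed
  define C where "C = (norm (x0 - zs))\<^sup>2 + 2 * c + 2 * (\<Sum>k. ?f k)"
  have "norm (X n \<omega>) \<le> norm zs + sqrt C" for n
  proof -
    have "(\<Sum>k<n. ?f k) \<le> (\<Sum>k. ?f k)"
      by (intro sum_le_suminf elim(2)) auto
    then have "(norm (X n \<omega> - zs))\<^sup>2 \<le> C"
      using V[of n] c[of n] unfolding C_def V_def by linarith
    then have "norm (X n \<omega> - zs) \<le> sqrt C"
      by (rule real_le_rsqrt)
    then show ?thesis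
      using norm_triangle_ineq[of zs "X n \<omega> - zs"] by simp
  qed
  then show ?case by blast
qed

end

section \<open>Asymptotics of the mean drift\<close>

context stochastic_proximal_point
begin

lemma norm_h_square_le: "(norm (h n x))\<^sup>2 \<le> (\<integral>s. (norm (Y n s x))\<^sup>2 \<partial>mu)"
  unfolding h_def by (rule mu.norm_integral_square_le[OF _ Y_square_integrable]) measurable

lemma h_square:
  "integrable P (\<lambda>\<omega>. (norm (h n (X n \<omega>)))\<^sup>2)"
  "(\<integral>\<omega>. (norm (h n (X n \<omega>)))\<^sup>2 \<partial>P) \<le> (\<integral>\<omega>. (norm (y n \<omega>))\<^sup>2 \<partial>P)"
proof -
  have "(\<integral>\<^sup>+\<omega>. ennreal ((norm (h n (X n \<omega>)))\<^sup>2) \<partial>P)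
      \<le> (\<integral>\<^sup>+\<omega>. ennreal (\<integral>s. (norm (Y n s (X n \<omega>)))\<^sup>2 \<partial>mu) \<partial>P)"
    by (intro nn_integral_mono ennreal_leI norm_h_square_le)
  also have "\<dots> = (\<integral>\<^sup>+\<omega>. \<integral>\<^sup>+s. ennreal ((norm (Y n s (X n \<omega>)))\<^sup>2) \<partial>mu \<partial>P)"
    by (intro nn_integral_cong nn_integral_eq_integral[symmetric] Y_square_integrable) simp
  also have "\<dots> = (\<integral>\<^sup>+\<omega>. ennreal ((norm (y n \<omega>))\<^sup>2) \<partial>P)"
    unfolding y_def
    using nn_integral_past_next[OF X_past[of n], of "\<lambda>p. ennreal ((norm (Y n (snd p) (fst p)))\<^sup>2)"]
    by simp
  also have "\<dots> = ennreal (\<integral>\<omega>. (norm (y n \<omega>))\<^sup>2 \<partial>P)"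
    by (intro nn_integral_eq_integral y_square_integrable) simp
  finally have le: "(\<integral>\<^sup>+\<omega>. ennreal ((norm (h n (X n \<omega>)))\<^sup>2) \<partial>P) \<le> ennreal (\<integral>\<omega>. (norm (y n \<omega>))\<^sup>2 \<partial>P)" .
  show int: "integrable P (\<lambda>\<omega>. (norm (h n (X n \<omega>)))\<^sup>2)"
    by (rule integrableI_bounded) (use le_less_trans[OF le ennreal_less_top] in auto)
  show "(\<integral>\<omega>. (norm (h n (X n \<omega>)))\<^sup>2 \<partial>P) \<le> (\<integral>\<omega>. (norm (y n \<omega>))\<^sup>2 \<partial>P)"
    using le by (subst (asm) nn_integral_eq_integral[OF int]) auto
qed

text \<open>
  The fluctuation \<open>lam n \<langle>y n - h n (X n), X n - u\<rangle>\<close> need not be square integrable, since only the second moments of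
  the two factors are controlled. Clipping the second factor at a level \<open>R\<close> preserves the martingale
  property, and almost every path is bounded, so it is unaffected for some \<open>R\<close>.
\<close>

definition clip :: "real \<Rightarrow> 'h \<Rightarrow> 'h" where "clip R v = (if norm v \<le> R then v else 0)"

lemma clip_measurable[measurable]: "clip R \<in> borel_measurable borel"
  unfolding clip_def by measurable

lemma norm_clip_le: "0 \<le> R \<Longrightarrow> norm (clip R v) \<le> R"
  by (simp add: clip_def)

definition fluctuation :: "'h \<Rightarrow> real \<Rightarrow> nat \<Rightarrow> 'w \<Rightarrow> real"
  where "fluctuation u R n \<omega> = lam n * inner (y n \<omega> - h n (X n \<omega>)) (clip R (X n \<omega> - u))"

lemma fluctuation_measurable[measurable]: "fluctuation u R n \<in> borel_measurable P"
  unfolding fluctuation_def by measurable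

lemma fluctuation_square:
  assumes R: "0 \<le> R"
  shows "integrable P (\<lambda>\<omega>. (fluctuation u R n \<omega>)\<^sup>2)"
    "(\<integral>\<omega>. (fluctuation u R n \<omega>)\<^sup>2 \<partial>P) \<le> 4 * R\<^sup>2 * ((lam n)\<^sup>2 * (\<integral>\<omega>. (norm (y n \<omega>))\<^sup>2 \<partial>P))"
proof -
  let ?B = "\<lambda>\<omega>. (lam n)\<^sup>2 * (R\<^sup>2 * (2 * (norm (y n \<omega>))\<^sup>2 + 2 * (norm (h n (X n \<omega>)))\<^sup>2))"
  have le: "(fluctuation u R n \<omega>)\<^sup>2 \<le> ?B \<omega>" for \<omega>
  proof -
    define a where "a = y n \<omega>"
    define b where "b = h n (X n \<omega>)"
    define w where "w = clip R (X n \<omega> - u)"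
    have "(norm (a - b))\<^sup>2 \<le> (norm a + norm b)\<^sup>2"
      by (intro power_mono norm_triangle_ineq4) simp
    also have "\<dots> \<le> 2 * (norm a)\<^sup>2 + 2 * (norm b)\<^sup>2"
      using sum_squares_bound[of "norm a" "norm b"] unfolding power2_sum by linarith
    finally have ab: "(norm (a - b))\<^sup>2 \<le> 2 * (norm a)\<^sup>2 + 2 * (norm b)\<^sup>2" .
    have w: "(norm w)\<^sup>2 \<le> R\<^sup>2"
      unfolding w_def by (intro power_mono norm_clip_le R) simp
    have "(inner (a - b) w)\<^sup>2 \<le> (norm w)\<^sup>2 * (norm (a - b))\<^sup>2"
      using Cauchy_Schwarz_ineq[of "a - b" w] by (simp add: power2_norm_eq_inner mult.commute)
    also have "\<dots> \<le> R\<^sup>2 * (2 * (norm a)\<^sup>2 + 2 * (norm b)\<^sup>2)"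
      by (intro mult_mono w ab) auto
    finally show ?thesis
      unfolding fluctuation_def power_mult_distrib a_def b_def w_def by (intro mult_left_mono) auto
  qed
  have int: "integrable P ?B"
    by (intro integrable_mult_right Bochner_Integration.integrable_add y_square_integrable h_square)
  show sq: "integrable P (\<lambda>\<omega>. (fluctuation u R n \<omega>)\<^sup>2)"
    by (rule Bochner_Integration.integrable_bound[OF int]) (use order_trans[OF le abs_ge_self] in auto)
  have "(\<integral>\<omega>. (fluctuation u R n \<omega>)\<^sup>2 \<partial>P) \<le> (\<integral>\<omega>. ?B \<omega> \<partial>P)"
    by (intro integral_mono sq int le)
  also have "\<dots> = (lam n)\<^sup>2 * (R\<^sup>2 * (2 * (\<integral>\<omega>. (norm (y n \<omega>))\<^sup>2 \<partial>P) + 2 * (\<integral>\<omega>. (norm (h n (X n \<omega>)))\<^sup>2 \<partial>P)))"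
    using y_square_integrable[of n] h_square(1)[of n] by simp
  also have "\<dots> \<le> (lam n)\<^sup>2 * (R\<^sup>2 * (2 * (\<integral>\<omega>. (norm (y n \<omega>))\<^sup>2 \<partial>P) + 2 * (\<integral>\<omega>. (norm (y n \<omega>))\<^sup>2 \<partial>P)))"
    by (intro mult_left_mono add_left_mono h_square) auto
  finally show "(\<integral>\<omega>. (fluctuation u R n \<omega>)\<^sup>2 \<partial>P) \<le> 4 * R\<^sup>2 * ((lam n)\<^sup>2 * (\<integral>\<omega>. (norm (y n \<omega>))\<^sup>2 \<partial>P))"
    by (simp add: algebra_simps)
qed

lemma fluctuation_orthogonal:
  assumes R: "0 \<le> R"
    and g: "g \<in> borel_measurable (past n)" "integrable P (\<lambda>\<omega>. (g \<omega>)\<^sup>2)"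
  shows "(\<integral>\<omega>. fluctuation u R n \<omega> * g \<omega> \<partial>P) = 0"
proof -
  let ?f = "\<lambda>p. lam n * inner (Y n (snd p) (fst (fst p)) - h n (fst (fst p))) (clip R (fst (fst p) - u)) * snd (fst p)"
  have "(\<integral>\<omega>. ?f ((X n \<omega>, g \<omega>), \<xi> (Suc n) \<omega>) \<partial>P) = 0"
  proof (rule integral_past_next_eq_0)
    show "(\<lambda>\<omega>. (X n \<omega>, g \<omega>)) \<in> measurable (past n) (borel \<Otimes>\<^sub>M borel)"
      using X_past[of n] g by measurable
    have "integrable P (\<lambda>\<omega>. fluctuation u R n \<omega> * g \<omega>)"
      using g measurable_from_subalg[OF subalgebra_past g(1)] fluctuation_square[OF R]
      by (intro integrable_mult_of_squares) auto
    then show "integrable P (\<lambda>\<omega>. ?f ((X n \<omega>, g \<omega>), \<xi> (Suc n) \<omega>))"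
      by (simp add: fluctuation_def y_def)
    show "(\<integral>s. ?f (z, s) \<partial>mu) = 0" for z
    proof -
      have "(\<integral>s. inner (Y n s (fst z) - h n (fst z)) (clip R (fst z - u)) \<partial>mu)
          = inner (\<integral>s. Y n s (fst z) - h n (fst z) \<partial>mu) (clip R (fst z - u))"
        using Y_integrable[of n "fst z"] by simp
      also have "(\<integral>s. Y n s (fst z) - h n (fst z) \<partial>mu) = 0"
        using Y_integrable[of n "fst z"] by (simp add: h_def mu.prob_space)
      finally show ?thesis by simp
    qed
  qed measurable
  then show ?thesis by (simp add: fluctuation_def y_def)
qed

lemma AE_fluctuation_bounded:
  assumes R: "0 \<le> R"
  shows "AE \<omega> in P. \<exists>c. \<forall>n. \<bar>\<Sum>k<n. fluctuation u R k \<omega>\<bar> \<le> c"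
proof -
  interpret fluct: square_integrable_martingale_differences P past "fluctuation u R"
  proof
    show "fluctuation u R n \<in> borel_measurable (past (Suc n))" for n
    proof -
      have [measurable]: "X n \<in> borel_measurable (past (Suc n))"
        by (rule measurable_past_SucI[OF X_past])
      have [measurable]: "\<xi> (Suc n) \<in> measurable (past (Suc n)) mu"
        by (rule measurable_coordinate_past) auto
      show ?thesis unfolding fluctuation_def y_def by measurable
    qed
  qed (use subalgebra_past past_mono fluctuation_square(1)[OF R] fluctuation_orthogonal[OF R] in auto)
  have "summable (\<lambda>n. \<integral>\<omega>. (fluctuation u R n \<omega>)\<^sup>2 \<partial>P)"
    using fluctuation_square(2)[OF R, of u]
    by (intro summable_comparison_test'[OF summable_mult[OF summable_y, of "4 * R\<^sup>2"], of 0]) simp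
  then show ?thesis by (rule fluct.AE_partial_sums_bounded)
qed

text \<open>The squared distances of the iterates to \<open>u\<close> telescope.\<close>

lemma sum_step_inner_eq:
  "2 * (\<Sum>k<n. lam k * inner (y k \<omega>) (X k \<omega> - u))
    = (norm (x0 - u))\<^sup>2 - (norm (X n \<omega> - u))\<^sup>2 + (\<Sum>k<n. (lam k)\<^sup>2 * (norm (y k \<omega>))\<^sup>2)"
proof (induction n)
  case (Suc n)
  have "(norm (X (Suc n) \<omega> - u))\<^sup>2
      = (norm (X n \<omega> - u))\<^sup>2 - 2 * (lam n * inner (y n \<omega>) (X n \<omega> - u)) + (lam n)\<^sup>2 * (norm (y n \<omega>))\<^sup>2"
    unfolding X_Suc_eq power2_norm_eq_inner
    by (simp add: inner_diff_left inner_diff_right inner_commute algebra_simps power2_eq_square)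
  with Suc show ?case
    unfolding sum.lessThan_Suc distrib_left by linarith
qed simp

text \<open>
  The path is bounded, so one of the countably many clipping levels \<open>R\<close> is never active; then the drift is the telescoping
  sum of \<open>lam k \<langle>y k, X k - u\<rangle>\<close> minus the fluctuations. Countability of \<open>U\<close> collects the exceptional sets.
\<close>

lemma AE_drift_bounded:
  assumes "countable U"
  shows "AE \<omega> in P. \<forall>u\<in>U. \<exists>c. \<forall>n. \<bar>\<Sum>k<n. lam k * inner (h k (X k \<omega>)) (X k \<omega> - u)\<bar> \<le> c"
proof -
  have "AE \<omega> in P. \<forall>u\<in>U. \<forall>R::nat. \<exists>c. \<forall>n. \<bar>\<Sum>k<n. fluctuation u R k \<omega>\<bar> \<le> c"
    unfolding AE_ball_countable[OF assms] AE_all_countable using AE_fluctuation_bounded by simp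
  with AE_X_bounded AE_summable_y show ?thesis
  proof eventually_elim
    case (elim \<omega>)
    obtain b where b: "\<And>n. norm (X n \<omega>) \<le> b" using elim(1) by blast
    show ?case
    proof
      fix u assume "u \<in> U"
      obtain R :: nat where R: "b + norm u \<le> R"
        using real_arch_simple by blast
      have XR: "norm (X n \<omega> - u) \<le> R" for n
        using b[of n] R norm_triangle_ineq4[of "X n \<omega>" u] by linarith
      obtain c where c: "\<And>n. \<bar>\<Sum>k<n. fluctuation u R k \<omega>\<bar> \<le> c"
        using elim(3) \<open>u \<in> U\<close> by blast
      let ?E = "\<Sum>k. (lam k)\<^sup>2 * (norm (y k \<omega>))\<^sup>2"
      have "\<bar>\<Sum>k<n. lam k * inner (h k (X k \<omega>)) (X k \<omega> - u)\<bar> \<le> (norm (x0 - u))\<^sup>2 + (real R)\<^sup>2 + ?E + c" for n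
      proof -
        have "(\<Sum>k<n. lam k * inner (h k (X k \<omega>)) (X k \<omega> - u))
            = (\<Sum>k<n. lam k * inner (y k \<omega>) (X k \<omega> - u)) - (\<Sum>k<n. fluctuation u R k \<omega>)"
          unfolding sum_subtractf[symmetric] fluctuation_def
          using XR by (intro sum.cong) (auto simp: clip_def inner_diff_left algebra_simps)
        moreover have "(norm (X n \<omega> - u))\<^sup>2 \<le> (real R)\<^sup>2"
          by (intro power_mono XR) simp
        moreover have "(\<Sum>k<n. (lam k)\<^sup>2 * (norm (y k \<omega>))\<^sup>2) \<le> ?E"
          by (intro sum_le_suminf elim(2)) auto
        moreover have "0 \<le> (\<Sum>k<n. (lam k)\<^sup>2 * (norm (y k \<omega>))\<^sup>2)"
          by (intro sum_nonneg) auto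
        moreover have "0 \<le> (norm (x0 - u))\<^sup>2" "0 \<le> (norm (X n \<omega> - u))\<^sup>2"
          by auto
        ultimately show ?thesis
          using sum_step_inner_eq[of \<omega> u n] c[of n] by linarith
      qed
      then show "\<exists>c. \<forall>n. \<bar>\<Sum>k<n. lam k * inner (h k (X k \<omega>)) (X k \<omega> - u)\<bar> \<le> c"
        by blast
    qed
  qed
qed

end

section \<open>Uniform integrability and the limit of the averages\<close>

lemma uniformly_integrable_cong_AE:
  assumes f: "uniformly_integrable M I f"
    and meas: "\<And>i. i \<in> I \<Longrightarrow> g i \<in> borel_measurable M" and nonneg: "\<And>i s. i \<in> I \<Longrightarrow> 0 \<le> g i s"
    and eq: "\<And>i. i \<in> I \<Longrightarrow> AE s in M. f i s = g i s"
  shows "uniformly_integrable M I g"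
proof -
  have "(\<integral>\<^sup>+ s \<in> {s \<in> space M. f i s > a}. ennreal (f i s) \<partial>M)
      = (\<integral>\<^sup>+ s \<in> {s \<in> space M. g i s > a}. ennreal (g i s) \<partial>M)" if "i \<in> I" for i a
    using eq[OF that] by (intro nn_integral_cong_AE) (auto simp: indicator_def)
  then show ?thesis
    using f meas nonneg unfolding uniformly_integrable_def by (simp cong: SUP_cong)
qed

text \<open>
  Both usual consequences of uniform integrability in one inequality: bounded integrals
  (\<open>S\<close> the whole space) and uniform absolute continuity (\<open>S\<close> small). Split at the level \<open>a\<close>.
\<close>

lemma uniformly_integrable_le:
  assumes f: "uniformly_integrable M I f" and \<epsilon>: "0 < \<epsilon>"
  shows "\<exists>a\<ge>0. \<forall>i\<in>I. \<forall>S\<in>sets M.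
    (\<integral>\<^sup>+s\<in>S. ennreal (f i s) \<partial>M) \<le> ennreal a * emeasure M S + ennreal \<epsilon>"
proof -
  let ?T = "\<lambda>a i. \<integral>\<^sup>+ s \<in> {s \<in> space M. f i s > a}. ennreal (f i s) \<partial>M"
  have "eventually (\<lambda>a. (SUP i\<in>I. ?T a i) < ennreal \<epsilon>) at_top"
    using f \<epsilon> unfolding uniformly_integrable_def by (intro order_tendstoD(2)) auto
  moreover have "eventually (\<lambda>a::real. 0 \<le> a) at_top"
    by (rule eventually_ge_at_top)
  ultimately have "eventually (\<lambda>a. 0 \<le> a \<and> (SUP i\<in>I. ?T a i) < ennreal \<epsilon>) at_top"
    by eventually_elim auto
  then obtain a where a: "0 \<le> a" "(SUP i\<in>I. ?T a i) < ennreal \<epsilon>"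
    by (auto dest!: eventually_happens)
  have "(\<integral>\<^sup>+s\<in>S. ennreal (f i s) \<partial>M) \<le> ennreal a * emeasure M S + ennreal \<epsilon>"
    if i: "i \<in> I" and S[measurable]: "S \<in> sets M" for i S
  proof -
    have [measurable]: "f i \<in> borel_measurable M"
      using f i by (auto simp: uniformly_integrable_def)
    have "(\<integral>\<^sup>+s\<in>S. ennreal (f i s) \<partial>M)
        \<le> (\<integral>\<^sup>+s. ennreal a * indicator S s + ennreal (f i s) * indicator {s \<in> space M. f i s > a} s \<partial>M)"
      by (intro nn_integral_mono) (auto simp: indicator_def intro: ennreal_leI)
    also have "\<dots> = ennreal a * emeasure M S + ?T a i"
      by (subst nn_integral_add) (auto simp: nn_integral_cmult_indicator)
    also have "?T a i \<le> (SUP i\<in>I. ?T a i)"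
      using i by (rule SUP_upper)
    also have "\<dots> \<le> ennreal \<epsilon>" using a by simp
    finally show ?thesis by (simp add: add_left_mono)
  qed
  then show ?thesis using a by blast
qed

lemma truncated_tail_tendsto_0:
  fixes g :: "'a \<Rightarrow> real"
  assumes g: "integrable M g" and f[measurable]: "f \<in> borel_measurable M"
  shows "(\<lambda>b::nat. \<integral>s. indicator {s\<in>space M. real b < f s} s * g s \<partial>M) \<longlonglongrightarrow> 0"
proof -
  note [measurable] = borel_measurable_integrable[OF g]
  have "(\<lambda>b::nat. \<integral>s. indicator {s\<in>space M. real b < f s} s * g s \<partial>M) \<longlonglongrightarrow> (\<integral>s. 0 \<partial>M)"
  proof (rule integral_dominated_convergence[where w="\<lambda>s. \<bar>g s\<bar>"])
    show "AE s in M. (\<lambda>b::nat. indicator {s\<in>space M. real b < f s} s * g s) \<longlonglongrightarrow> 0"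
    proof (rule AE_I2)
      fix s
      obtain n :: nat where "f s \<le> n" using real_arch_simple by blast
      then have "eventually (\<lambda>b::nat. indicator {s\<in>space M. real b < f s} s * g s = 0) sequentially"
        by (intro eventually_sequentiallyI[of n]) (auto simp: indicator_def)
      then show "(\<lambda>b::nat. indicator {s\<in>space M. real b < f s} s * g s) \<longlonglongrightarrow> 0"
        by (rule tendsto_eventually)
    qed
  qed (use g in \<open>auto simp: indicator_def\<close>)
  then show ?thesis by simp
qed

lemma selections_1_D:
  fixes A :: "'e \<Rightarrow> 'h \<Rightarrow> 'h::{banach, second_countable_topology} set"
  assumes "\<psi> \<in> selections M A 1 u"
  shows "integrable M \<psi>" "AE s in M. \<psi> s \<in> A s u"
proof -
  have *: "\<psi> \<in> borel_measurable M" "(\<integral>\<^sup>+ s. ennreal (norm (\<psi> s)) \<partial>M) < \<infinity>"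
    using assms by (simp_all add: selections_def)
  then show "integrable M \<psi>" by (rule integrableI_bounded)
  show "AE s in M. \<psi> s \<in> A s u"
    using assms by (simp add: selections_def)
qed

context stochastic_proximal_point
begin

text \<open>
  Pointwise comparison of \<open>\<psi>\<close> with the Yosida approximation, integrated. Almost monotonicity costs
  \<open>lam n |\<psi>|\<^sup>2 / 4\<close>, which is integrable in \<open>s\<close> only after truncation since \<open>\<psi>\<close> is merely in \<open>L\<^sup>1\<close>; on
  the set \<open>|\<psi>| > b\<close> the Cauchy--Schwarz inequality is used instead.
\<close>

lemma inner_mean_selection_le:
  assumes v: "norm (x - u) \<le> C" and \<psi>: "\<psi> \<in> selections mu A 1 u" and b: "0 \<le> b"
  shows "inner (\<integral>s. \<psi> s \<partial>mu) (x - u) \<le> inner (h n x) (x - u) + lam n * b\<^sup>2 / 4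
    + C * ((\<integral>s. indicator {s\<in>space mu. b < norm (\<psi> s)} s * norm (Y n s x) \<partial>mu)
        + (\<integral>s. indicator {s\<in>space mu. b < norm (\<psi> s)} s * norm (\<psi> s) \<partial>mu))"
proof -
  let ?S = "{s\<in>space mu. b < norm (\<psi> s)}"
  have \<psi>_int: "integrable mu \<psi>" and \<psi>_sel: "AE s in mu. \<psi> s \<in> A s u"
    using selections_1_D[OF \<psi>] by auto
  note [measurable] = borel_measurable_integrable[OF \<psi>_int]
  have Y: "integrable mu (\<lambda>s. Y n s x)" by (rule Y_integrable)
  have C: "0 \<le> C" using norm_ge_zero v by (rule order_trans)
  have iY: "integrable mu (\<lambda>s. indicator ?S s * norm (Y n s x))"
    by (rule Bochner_Integration.integrable_bound[OF integrable_norm[OF Y]]) (auto simp: indicator_def)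
  have i\<psi>: "integrable mu (\<lambda>s. indicator ?S s * norm (\<psi> s))"
    by (rule Bochner_Integration.integrable_bound[OF integrable_norm[OF \<psi>_int]]) (auto simp: indicator_def)
  have "inner (\<integral>s. \<psi> s \<partial>mu) (x - u) = (\<integral>s. inner (\<psi> s) (x - u) \<partial>mu)"
    using \<psi>_int by simp
  also have "\<dots> \<le> (\<integral>s. inner (Y n s x) (x - u) + lam n * b\<^sup>2 / 4
      + C * (indicator ?S s * norm (Y n s x) + indicator ?S s * norm (\<psi> s)) \<partial>mu)"
  proof (rule integral_mono_AE)
    show "integrable mu (\<lambda>s. inner (\<psi> s) (x - u))"
      using \<psi>_int by simp
    show "integrable mu (\<lambda>s. inner (Y n s x) (x - u) + lam n * b\<^sup>2 / 4
      + C * (indicator ?S s * norm (Y n s x) + indicator ?S s * norm (\<psi> s)))"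
      using Y iY i\<psi> by simp
    show "AE s in mu. inner (\<psi> s) (x - u) \<le> inner (Y n s x) (x - u) + lam n * b\<^sup>2 / 4
      + C * (indicator ?S s * norm (Y n s x) + indicator ?S s * norm (\<psi> s))"
      using \<psi>_sel AE_space
    proof eventually_elim
      case (elim s)
      show ?case
      proof (cases "s \<in> ?S")
        case True
        have "inner (\<psi> s) (x - u) \<le> norm (\<psi> s) * C"
          by (rule order_trans[OF norm_cauchy_schwarz]) (intro mult_left_mono v norm_ge_zero)
        moreover have "- inner (Y n s x) (x - u) \<le> norm (Y n s x) * C"
          using norm_cauchy_schwarz[of "- Y n s x" "x - u"] mult_left_mono[OF v, of "norm (Y n s x)"] by simp
        moreover have "0 \<le> lam n * b\<^sup>2 / 4" using lam_pos[of n] by simp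
        ultimately show ?thesis using True by (simp add: algebra_simps)
      next
        case False
        then have "norm (\<psi> s) \<le> b" using elim by simp
        then have "lam n * (norm (\<psi> s))\<^sup>2 \<le> lam n * b\<^sup>2"
          using lam_pos[of n] by (intro mult_left_mono power_mono) auto
        then show ?thesis
          using False yosida_almost_monotone[of A s "lam n" "\<psi> s" u x, OF maximal lam_pos elim(1)]
          by (simp add: inner_diff_left)
      qed
    qed
  qed
  also have "\<dots> = inner (h n x) (x - u) + lam n * b\<^sup>2 / 4
      + C * ((\<integral>s. indicator ?S s * norm (Y n s x) \<partial>mu) + (\<integral>s. indicator ?S s * norm (\<psi> s) \<partial>mu))"
    using Y iY i\<psi> by (simp add: h_def mu.prob_space)
  finally show ?thesis .
qed

text \<open>
  The weighted averages of \<open>mass v S\<close> are the integrals over \<open>S\<close> of the functions whose uniform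
  integrability is assumed.
\<close>

definition mass :: "(nat \<Rightarrow> 'h) \<Rightarrow> 'e set \<Rightarrow> nat \<Rightarrow> real"
  where "mass v S k = (\<integral>s. indicator S s * norm (Y k s (v k)) \<partial>mu)"

lemma mass_integrable:
  assumes "S \<in> sets mu"
  shows "integrable mu (\<lambda>s. indicator S s * norm (Y k s (v k)))"
  by (rule Bochner_Integration.integrable_bound[OF integrable_norm[OF Y_integrable[of k "v k"]]])
    (use assms in \<open>auto simp: indicator_def\<close>)

lemma norm_h_le_mass: "norm (h k (v k)) \<le> mass v (space mu) k"
proof -
  have "norm (h k (v k)) \<le> (\<integral>s. norm (Y k s (v k)) \<partial>mu)"
    unfolding h_def by (rule integral_norm_bound)
  also have "\<dots> = mass v (space mu) k"
    unfolding mass_def by (intro Bochner_Integration.integral_cong) auto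
  finally show ?thesis .
qed

lemma avg_mass_le:
  assumes UI: "UI_bar mu A lam v" and \<delta>: "0 < \<delta>"
  obtains a where "0 \<le> a" "\<And>n S. 1 \<le> n \<Longrightarrow> S \<in> sets mu \<Longrightarrow> avg n (mass v S) \<le> a * measure mu S + \<delta>"
proof -
  let ?f = "\<lambda>n s. (\<Sum>k=1..n. lam k * norm (Y k s (v k))) / (\<Sum>k=1..n. lam k)"
  obtain a where a: "0 \<le> a" "\<And>n S. 1 \<le> n \<Longrightarrow> S \<in> sets mu \<Longrightarrow>
    (\<integral>\<^sup>+s\<in>S. ennreal (?f n s) \<partial>mu) \<le> ennreal a * emeasure mu S + ennreal \<delta>"
    using uniformly_integrable_le[OF UI[unfolded UI_bar_def] \<delta>] by fastforce
  have "avg n (mass v S) \<le> a * measure mu S + \<delta>" if n: "1 \<le> n" and S: "S \<in> sets mu" for n S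
  proof -
    have f: "?f n s * indicator S s = (\<Sum>k=1..n. lam k * (indicator S s * norm (Y k s (v k)))) / total n" for s
      unfolding total_def by (simp add: sum_distrib_left sum_distrib_right ac_simps)
    have int: "integrable mu (\<lambda>s. ?f n s * indicator S s)"
      unfolding f using mass_integrable[OF S] by simp
    have nonneg: "0 \<le> ?f n s * indicator S s" for s
      using lam_pos by (intro mult_nonneg_nonneg divide_nonneg_nonneg sum_nonneg) (auto intro: less_imp_le)
    have "avg n (mass v S) = (\<integral>s. ?f n s * indicator S s \<partial>mu)"
      unfolding f avg_def mass_def using mass_integrable[OF S] by simp
    then have "ennreal (avg n (mass v S)) = (\<integral>\<^sup>+s. ennreal (?f n s * indicator S s) \<partial>mu)"
      using int nonneg by (simp add: nn_integral_eq_integral)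
    also have "\<dots> = (\<integral>\<^sup>+s\<in>S. ennreal (?f n s) \<partial>mu)"
      by (intro nn_integral_cong) (auto simp: indicator_def)
    also have "\<dots> \<le> ennreal a * emeasure mu S + ennreal \<delta>"
      by (rule a(2)[OF n S])
    also have "\<dots> = ennreal (a * measure mu S + \<delta>)"
      using a(1) \<delta> by (simp add: mu.emeasure_eq_measure ennreal_mult)
    finally show ?thesis
      using a(1) \<delta> by (subst (asm) ennreal_le_iff) (auto intro!: add_nonneg_nonneg)
  qed
  then show thesis using a(1) that by blast
qed

text \<open>
  The average is Lipschitz in \<open>u\<close> uniformly in \<open>n\<close>, with the bound \<open>K\<close> on the averages of
  \<open>|h k (v k)|\<close> as constant, so the dense set \<open>U\<close> suffices.
\<close>

lemma avg_drift_le: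
  assumes UI: "UI_bar mu A lam v"
    and dense: "\<And>u \<delta>. 0 < \<delta> \<Longrightarrow> \<exists>u'\<in>U. dist u' u < \<delta>"
    and drift: "\<And>u. u \<in> U \<Longrightarrow> \<exists>c. \<forall>n. \<bar>\<Sum>k<n. lam k * inner (h k (v k)) (v k - u)\<bar> \<le> c"
    and \<delta>: "0 < \<delta>"
  shows "eventually (\<lambda>n. avg n (\<lambda>k. inner (h k (v k)) (v k - u)) \<le> \<delta>) sequentially"
proof -
  obtain K where K: "0 < K" "\<And>n. 1 \<le> n \<Longrightarrow> avg n (mass v (space mu)) \<le> K"
  proof -
    obtain a where a: "0 \<le> a" "\<And>n S. 1 \<le> n \<Longrightarrow> S \<in> sets mu \<Longrightarrow> avg n (mass v S) \<le> a * measure mu S + 1"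
      using avg_mass_le[OF UI, of 1] by auto
    show thesis
      using a(1) a(2)[OF _ sets.top] by (intro that[of "a + 1"]) (auto simp: mu.prob_space)
  qed
  obtain u' where u': "u' \<in> U" "dist u' u < \<delta> / (2 * K)"
    using dense[of "\<delta> / (2 * K)" u] \<delta> K(1) by auto
  obtain r where "\<And>n. \<bar>\<Sum>k<n. lam k * inner (h k (v k)) (v k - u')\<bar> \<le> r"
    using drift[OF u'(1)] by blast
  then have "(\<lambda>n. avg n (\<lambda>k. inner (h k (v k)) (v k - u'))) \<longlonglongrightarrow> 0"
    by (rule avg_tendsto_0)
  then have "eventually (\<lambda>n. avg n (\<lambda>k. inner (h k (v k)) (v k - u')) < \<delta> / 2) sequentially"
    using \<delta> by (intro order_tendstoD(2)) auto
  then show ?thesis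
    using eventually_ge_at_top[of 1]
  proof eventually_elim
    case (elim n)
    have "avg n (\<lambda>k. inner (h k (v k)) (v k - u))
        \<le> avg n (\<lambda>k. inner (h k (v k)) (v k - u') + norm (u' - u) * mass v (space mu) k)"
    proof (rule avg_mono[OF elim(2)])
      fix k
      have "inner (h k (v k)) (v k - u) = inner (h k (v k)) (v k - u') + inner (h k (v k)) (u' - u)"
        by (simp add: inner_diff_right)
      also have "inner (h k (v k)) (u' - u) \<le> norm (h k (v k)) * norm (u' - u)"
        by (rule norm_cauchy_schwarz)
      also have "\<dots> \<le> norm (u' - u) * mass v (space mu) k"
        using mult_right_mono[OF norm_h_le_mass[of k v], of "norm (u' - u)"] by (simp add: mult.commute)
      finally show "inner (h k (v k)) (v k - u)
          \<le> inner (h k (v k)) (v k - u') + norm (u' - u) * mass v (space mu) k" by simp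
    qed
    also have "\<dots> = avg n (\<lambda>k. inner (h k (v k)) (v k - u')) + norm (u' - u) * avg n (mass v (space mu))"
      unfolding avg_add avg_mult ..
    also have "norm (u' - u) * avg n (mass v (space mu)) \<le> norm (u' - u) * K"
      by (intro mult_left_mono K(2)[OF elim(2)]) simp
    also have "\<dots> \<le> \<delta> / (2 * K) * K"
      using u'(2) K(1) by (intro mult_right_mono) (auto simp: dist_norm)
    also have "\<dots> = \<delta> / 2" using K(1) by simp
    finally show ?case using elim(1) by simp
  qed
qed

text \<open>
  A purely deterministic statement about one path \<open>v\<close>. The level \<open>b\<close> is chosen before \<open>n\<close>: the
  contribution of the tail set \<open>T b\<close> is small uniformly in \<open>n\<close>, after which the truncation error
  \<open>b\<^sup>2/4\<close> times the average of the step sizes tends to \<open>0\<close> because \<open>\<Sum> (lam k)\<^sup>2 < \<infinity>\<close>.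
\<close>

lemma averages_limit:
  assumes bdd: "\<And>n. norm (v n) \<le> c" and UI: "UI_bar mu A lam v"
    and dense: "\<And>u \<delta>. 0 < \<delta> \<Longrightarrow> \<exists>u'\<in>U. dist u' u < \<delta>"
    and drift: "\<And>u. u \<in> U \<Longrightarrow> \<exists>c. \<forall>n. \<bar>\<Sum>k<n. lam k * inner (h k (v k)) (v k - u)\<bar> \<le> c"
    and \<psi>: "\<psi> \<in> selections mu A 1 u" and \<epsilon>: "0 < \<epsilon>"
  shows "eventually (\<lambda>n. inner (\<integral>s. \<psi> s \<partial>mu) ((\<Sum>k=1..n. lam k *\<^sub>R v k) /\<^sub>R (\<Sum>k=1..n. lam k)) \<le>
    inner (\<integral>s. \<psi> s \<partial>mu) u + \<epsilon>) sequentially"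
proof -
  define C where "C = c + norm u + 1"
  have vC: "norm (v k - u) \<le> C" for k
    using bdd[of k] norm_triangle_ineq4[of "v k" u] unfolding C_def by linarith
  have C: "0 < C"
    using norm_ge_zero[of "v 0"] bdd[of 0] norm_ge_zero[of u] unfolding C_def by linarith
  have \<psi>_int: "integrable mu \<psi>"
    by (rule selections_1_D[OF \<psi>])
  note \<psi>_meas[measurable] = borel_measurable_integrable[OF \<psi>_int]
  define T where "T b = {s\<in>space mu. b < norm (\<psi> s)}" for b
  have T[measurable]: "T b \<in> sets mu" for b unfolding T_def by measurable
  obtain a where a: "0 \<le> a" "\<And>n S. 1 \<le> n \<Longrightarrow> S \<in> sets mu \<Longrightarrow>
      avg n (mass v S) \<le> a * measure mu S + \<epsilon> / (4 * C)"
    using avg_mass_le[OF UI, of "\<epsilon> / (4 * C)"] \<epsilon> C by auto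
  obtain b :: nat where b: "(\<integral>s. indicator (T b) s * (a + norm (\<psi> s)) \<partial>mu) < \<epsilon> / (4 * C)"
  proof -
    have "(\<lambda>b::nat. \<integral>s. indicator (T b) s * (a + norm (\<psi> s)) \<partial>mu) \<longlonglongrightarrow> 0"
      unfolding T_def using \<psi>_int by (intro truncated_tail_tendsto_0) auto
    then have "eventually (\<lambda>b. (\<integral>s. indicator (T (real b)) s * (a + norm (\<psi> s)) \<partial>mu) < \<epsilon> / (4 * C)) sequentially"
      using \<epsilon> C by (intro order_tendstoD(2)) auto
    then show thesis using that by (auto dest!: eventually_happens)
  qed
  let ?\<tau> = "\<integral>s. indicator (T b) s * norm (\<psi> s) \<partial>mu"
  have T_int: "integrable mu (\<lambda>s. indicator (T b) s * norm (\<psi> s))"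
    by (rule Bochner_Integration.integrable_bound[OF integrable_norm[OF \<psi>_int]]) (auto simp: indicator_def)
  have "(\<integral>s. indicator (T b) s * (a + norm (\<psi> s)) \<partial>mu) = a * measure mu (T b) + ?\<tau>"
  proof -
    have "integrable mu (\<lambda>s. indicator (T b) s * a)"
      by (intro integrable_mult_left integrable_real_indicator) (auto simp: mu.emeasure_eq_measure)
    then show ?thesis
      using T_int unfolding distrib_left by (simp add: mult.commute)
  qed
  then have tail: "a * measure mu (T b) + ?\<tau> < \<epsilon> / (4 * C)"
    using b by simp
  have "(\<lambda>n. avg n lam) \<longlonglongrightarrow> 0"
  proof (rule avg_tendsto_0)
    fix n
    have "(\<Sum>k<n. lam k * lam k) \<le> (\<Sum>k. (lam k)\<^sup>2)"
      unfolding power2_eq_square[symmetric] by (intro sum_le_suminf lam_sq) auto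
    moreover have "0 \<le> (\<Sum>k<n. lam k * lam k)"
      by (intro sum_nonneg) auto
    ultimately show "\<bar>\<Sum>k<n. lam k * lam k\<bar> \<le> (\<Sum>k. (lam k)\<^sup>2)" by simp
  qed
  then have "(\<lambda>n. (real b)\<^sup>2 / 4 * avg n lam) \<longlonglongrightarrow> 0"
    by (rule tendsto_mult_right_zero)
  then have "eventually (\<lambda>n. (real b)\<^sup>2 / 4 * avg n lam < \<epsilon> / 4) sequentially"
    by (rule order_tendstoD(2)) (use \<epsilon> in simp)
  moreover have "eventually (\<lambda>n. avg n (\<lambda>k. inner (h k (v k)) (v k - u)) \<le> \<epsilon> / 4) sequentially"
    using \<epsilon> by (intro avg_drift_le[OF UI dense drift]) auto
  ultimately show ?thesis
    using eventually_ge_at_top[of 1]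
  proof eventually_elim
    case (elim n)
    let ?m = "\<integral>s. \<psi> s \<partial>mu"
    have "inner ?m ((\<Sum>k=1..n. lam k *\<^sub>R v k) /\<^sub>R (\<Sum>k=1..n. lam k)) - inner ?m u
        = avg n (\<lambda>k. inner ?m (v k) + (- inner ?m u))"
      unfolding avg_add avg_const[OF elim(3)]
      by (simp add: avg_def total_def inner_sum_right divide_inverse mult.commute)
    also have "\<dots> = avg n (\<lambda>k. inner ?m (v k - u))"
      by (simp add: inner_diff_right)
    also have "\<dots> \<le> avg n (\<lambda>k. inner (h k (v k)) (v k - u) + (real b)\<^sup>2 / 4 * lam k + C * (mass v (T b) k + ?\<tau>))"
      using inner_mean_selection_le[OF vC \<psi>, of "real b"] unfolding mass_def T_def
      by (intro avg_mono[OF elim(3)]) (simp add: mult.commute)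
    also have "\<dots> = avg n (\<lambda>k. inner (h k (v k)) (v k - u)) + (real b)\<^sup>2 / 4 * avg n lam
        + C * (avg n (mass v (T b)) + ?\<tau>)"
      unfolding avg_add avg_mult avg_const[OF elim(3)] ..
    also have "\<dots> \<le> \<epsilon> / 4 + \<epsilon> / 4 + C * (2 * (\<epsilon> / (4 * C)))"
      using elim(1,2) a(2)[OF elim(3) T, of b] tail C by (intro add_mono mult_left_mono) auto
    also have "\<dots> = \<epsilon>" using C by simp
    finally show ?case by simp
  qed
qed

end

text \<open>An open half-space is weakly open, as the preimage of an open set under evaluation at one functional.\<close>

lemma weak_cluster_point_inner_le:
  fixes w :: "nat \<Rightarrow> 'h::real_inner"
  assumes z: "weak_cluster_point w z"
    and le: "\<And>\<epsilon>. 0 < \<epsilon> \<Longrightarrow> eventually (\<lambda>n. inner m (w n) \<le> r + \<epsilon>) sequentially"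
  shows "inner m z \<le> r"
proof (rule field_le_epsilon)
  fix \<epsilon> :: real assume "0 < \<epsilon>"
  define f :: "'h \<Rightarrow>\<^sub>L real" where "f = Blinfun (inner m)"
  have f: "blinfun_apply f x = inner m x" for x
    unfolding f_def by (simp add: bounded_linear_Blinfun_apply bounded_linear_inner_right)
  let ?O = "{g :: ('h \<Rightarrow>\<^sub>L real) \<Rightarrow> real. inner m z - \<epsilon> / 2 < g f}"
  let ?U = "{x. inner m z - \<epsilon> / 2 < inner m x}"
  have "open ?O"
    by (intro open_Collect_less continuous_on_const continuous_on_product_coordinates)
  then have "openin weak_topology ?U"
    unfolding weak_topology_def openin_pullback_topology
    by (intro exI[of _ ?O]) (auto simp: f)
  then have "\<exists>\<^sub>F n in sequentially. w n \<in> ?U"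
    using z \<open>0 < \<epsilon>\<close> unfolding weak_cluster_point_def by auto
  then have "\<exists>\<^sub>F n in sequentially. w n \<in> ?U \<and> inner m (w n) \<le> r + \<epsilon> / 2"
    using frequently_eventually_conj[of "\<lambda>n. w n \<in> ?U" sequentially, OF _ le[of "\<epsilon> / 2"]] \<open>0 < \<epsilon>\<close>
    by (simp add: conj_commute)
  then obtain n where "w n \<in> ?U" "inner m (w n) \<le> r + \<epsilon> / 2"
    by (auto dest: frequently_ex)
  then show "inner m z \<le> r + \<epsilon>" by simp
qed

section \<open>Convergence of the averages\<close>

lemma selections_cong_AE:
  assumes "AE s in M. A s = A' s"
  shows "selections M A p x = selections M A' p x"
proof -
  have "(AE s in M. \<phi> s \<in> A s x) \<longleftrightarrow> (AE s in M. \<phi> s \<in> A' s x)" for \<phi>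
    using assms by (intro eventually_cong) (auto elim: eventually_mono)
  then show ?thesis by (simp add: selections_def)
qed

lemma countable_dense_near:
  obtains U :: "'a::{metric_space, second_countable_topology} set"
  where "countable U" "\<And>u \<delta>. 0 < \<delta> \<Longrightarrow> \<exists>u'\<in>U. dist u' u < \<delta>"
proof -
  obtain U :: "'a set" where U: "countable U" "\<And>X. open X \<Longrightarrow> X \<noteq> {} \<Longrightarrow> \<exists>d\<in>U. d \<in> X"
    using countable_dense_setE by blast
  have "\<exists>u'\<in>U. dist u' u < \<delta>" if "0 < \<delta>" for u \<delta>
    using U(2)[of "ball u \<delta>"] that by (auto simp: dist_commute)
  with U(1) show thesis by (rule that)
qed

theorem theorem1:
  fixes mu :: "'e measure"
    and A :: "'e \<Rightarrow> 'h \<Rightarrow> ('h::{real_inner, banach, second_countable_topology}) set"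
    and P :: "'w measure"
    and \<xi> :: "nat \<Rightarrow> 'w \<Rightarrow> 'e"
    and lam :: "nat \<Rightarrow> real"
    and x0 :: 'h
    and x :: "nat \<Rightarrow> 'w \<Rightarrow> 'h"
    and G :: "'w set"
  assumes mu: "prob_space mu" "complete_measure mu"
    and P: "prob_space P"
    and A_maximal: "AE s in mu. maximal_monotone (A s)"
    and resolvent_measurable:
      "\<And>r y. 0 < r \<Longrightarrow> (\<lambda>s. resolvent A r s y) \<in> borel_measurable mu"
    and lam_pos: "\<And>n. 0 < lam n"
    and lam_sum: "filterlim (\<lambda>n. \<Sum>k<n. lam k) at_top sequentially"
    and lam_sq: "summable (\<lambda>n. (lam n)\<^sup>2)"
    and \<xi>_measurable: "\<And>n. 1 \<le> n \<Longrightarrow> \<xi> n \<in> measurable P mu"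
    and \<xi>_indep: "prob_space.indep_vars P (\<lambda>_. mu) \<xi> {1..}"
    and \<xi>_distr: "\<And>n. 1 \<le> n \<Longrightarrow> distr P mu (\<xi> n) = mu"
    and mean_maximal: "maximal_monotone (mean_operator mu A)"
    and Z2: "zer_sel mu A 2 \<noteq> {}"
    and x_0: "\<And>\<omega>. \<omega> \<in> space P \<Longrightarrow> x 0 \<omega> = x0"
    and x_Suc: "\<And>n \<omega>. \<omega> \<in> space P \<Longrightarrow>
      x (Suc n) \<omega> = resolvent A (lam n) (\<xi> (Suc n) \<omega>) (x n \<omega>)"
    and G: "G \<in> sets P" "AE \<omega> in P. \<omega> \<in> G \<longrightarrow> UI_bar mu A lam (\<lambda>n. x n \<omega>)"
  shows "\<exists>B\<in>sets P. measure P B = 1 \<and>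
    (\<forall>\<omega>\<in>B \<inter> G. \<forall>z.
      weak_cluster_point
        (\<lambda>n. (\<Sum>k=1..n. lam k *\<^sub>R x k \<omega>) /\<^sub>R (\<Sum>k=1..n. lam k)) z
      \<longrightarrow> z \<in> zer (mean_operator mu A))"
proof -
  interpret P: prob_space P by (rule P)
  obtain N where N: "N \<in> sets mu" "emeasure mu N = 0" "{s\<in>space mu. \<not> maximal_monotone (A s)} \<subseteq> N"
    using AE_E[OF A_maximal] by metis
  \<comment> \<open>Repairing \<open>A\<close> on the null set keeps the mean operator and, almost surely, the iteration.\<close>
  define A' where "A' s = (if s \<in> space mu - N then A s else (\<lambda>_. {0}))" for s
  have A'_maximal: "maximal_monotone (A' s)" for s
    using N(3) maximal_monotone_zero by (auto simp: A'_def)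
  have AE_N: "AE s in mu. s \<notin> N"
    using N by (intro AE_not_in) auto
  then have A'_eq: "AE s in mu. A s = A' s"
    using AE_space by eventually_elim (simp add: A'_def)
  have A'_resolvent: "(\<lambda>s. resolvent A' r s y) \<in> borel_measurable mu" if r: "0 < r" for r y
  proof -
    have "(\<lambda>s. if s \<in> N then y else resolvent A r s y) \<in> borel_measurable mu"
      using resolvent_measurable[OF r, of y] N(1) by measurable
    then show ?thesis
    proof (rule measurable_cong[THEN iffD1, rotated])
      fix s assume "s \<in> space mu"
      then show "(if s \<in> N then y else resolvent A r s y) = resolvent A' r s y"
        using resolvent_zero_operator[of A' s r y] resolvent_cong[of A s A' r y] r by (simp add: A'_def)
    qed
  qed
  obtain zs \<phi> where \<phi>: "\<phi> \<in> selections mu A' 2 zs" "(\<integral>s. \<phi> s \<partial>mu) = 0"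
    using Z2 unfolding zer_sel_def selections_cong_AE[OF A'_eq] by blast
  have \<phi>_meas[measurable]: "\<phi> \<in> borel_measurable mu" and \<phi>_sel: "AE s in mu. \<phi> s \<in> A' s zs"
    and "(\<integral>\<^sup>+ s. ennreal (norm (\<phi> s) powr 2) \<partial>mu) < \<infinity>"
    using \<phi>(1) by (auto simp: selections_def)
  then have \<phi>_sq: "integrable mu (\<lambda>s. (norm (\<phi> s))\<^sup>2)"
    by (intro integrableI_bounded) auto
  interpret spp: stochastic_proximal_point P mu \<xi> lam A' x0 zs \<phi>
    by unfold_locales
      (fact \<xi>_measurable \<xi>_indep \<xi>_distr lam_pos lam_sum A'_maximal A'_resolvent lam_sq \<phi>_meas \<phi>_sel \<phi>_sq \<phi>(2))+
  obtain U :: "'h set" where U: "countable U" "\<And>u \<delta>. 0 < \<delta> \<Longrightarrow> \<exists>u'\<in>U. dist u' u < \<delta>"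
    using countable_dense_near by metis
  have "AE \<omega> in P. \<forall>n. \<xi> (Suc n) \<omega> \<notin> N"
    unfolding AE_all_countable using spp.AE_next[OF AE_N] by blast
  with spp.AE_X_bounded spp.AE_drift_bounded[OF U(1)] G(2) AE_space
  have "AE \<omega> in P. \<omega> \<in> G \<longrightarrow> (\<forall>z.
      weak_cluster_point (\<lambda>n. (\<Sum>k=1..n. lam k *\<^sub>R x k \<omega>) /\<^sub>R (\<Sum>k=1..n. lam k)) z
      \<longrightarrow> z \<in> zer (mean_operator mu A))"
  proof eventually_elim
    case (elim \<omega>)
    have x_eq: "x n \<omega> = spp.X n \<omega>" for n
    proof (induction n)
      case 0
      show ?case using elim(4) by (simp add: x_0)
    next
      case (Suc n)
      have "\<xi> (Suc n) \<omega> \<in> space mu"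
        using measurable_space[OF \<xi>_measurable elim(4)] by simp
      then have "A (\<xi> (Suc n) \<omega>) = A' (\<xi> (Suc n) \<omega>)"
        using elim(5) by (simp add: A'_def)
      then show ?case
        using elim(4) Suc by (simp add: x_Suc resolvent_cong[of A _ A'])
    qed
    obtain c where c: "\<And>n. norm (spp.X n \<omega>) \<le> c" using elim(1) by blast
    show ?case
    proof (intro impI allI)
      fix z
      assume "\<omega> \<in> G" and z: "weak_cluster_point (\<lambda>n. (\<Sum>k=1..n. lam k *\<^sub>R x k \<omega>) /\<^sub>R (\<Sum>k=1..n. lam k)) z"
      have UI: "UI_bar mu A' lam (\<lambda>n. spp.X n \<omega>)"
        unfolding UI_bar_def
      proof (rule uniformly_integrable_cong_AE)
        show "uniformly_integrable mu {1..}
            (\<lambda>n s. (\<Sum>k=1..n. lam k * norm (yosida A (lam k) s (spp.X k \<omega>))) / (\<Sum>k=1..n. lam k))"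
          using elim(3) \<open>\<omega> \<in> G\<close> by (simp add: UI_bar_def x_eq)
        show "AE s in mu. (\<Sum>k=1..n. lam k * norm (yosida A (lam k) s (spp.X k \<omega>))) / (\<Sum>k=1..n. lam k)
            = (\<Sum>k=1..n. lam k * norm (yosida A' (lam k) s (spp.X k \<omega>))) / (\<Sum>k=1..n. lam k)" for n
          using A'_eq by eventually_elim (simp add: yosida_def cong: resolvent_cong)
      qed (auto intro!: divide_nonneg_nonneg sum_nonneg mult_nonneg_nonneg simp: less_imp_le[OF lam_pos])
      have "0 \<in> mean_operator mu A z"
      proof (rule maximal_monotone_memI[OF mean_maximal])
        fix u m assume "m \<in> mean_operator mu A u"
        then obtain \<psi> where \<psi>: "\<psi> \<in> selections mu A' 1 u" "m = (\<integral>s. \<psi> s \<partial>mu)"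
          unfolding mean_operator_def selections_cong_AE[OF A'_eq] by blast
        have "inner m z \<le> inner m u"
          unfolding \<psi>(2)
        proof (rule weak_cluster_point_inner_le[OF z])
          fix \<epsilon> :: real assume "0 < \<epsilon>"
          then show "\<forall>\<^sub>F n in sequentially.
            inner (\<integral>s. \<psi> s \<partial>mu) ((\<Sum>k=1..n. lam k *\<^sub>R x k \<omega>) /\<^sub>R (\<Sum>k=1..n. lam k))
              \<le> inner (\<integral>s. \<psi> s \<partial>mu) u + \<epsilon>"
            unfolding x_eq using elim(2) by (intro spp.averages_limit[OF c UI U(2) _ \<psi>(1)]) auto
        qed
        then show "0 \<le> inner (m - 0) (u - z)" by (simp add: inner_diff_right)
      qed
      then show "z \<in> zer (mean_operator mu A)" by (simp add: zer_def)
    qed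
  qed
  then obtain M where M: "M \<in> sets P" "emeasure P M = 0"
    and *: "\<And>\<omega>. \<omega> \<in> space P - M \<Longrightarrow> \<omega> \<in> G \<longrightarrow> (\<forall>z.
      weak_cluster_point (\<lambda>n. (\<Sum>k=1..n. lam k *\<^sub>R x k \<omega>) /\<^sub>R (\<Sum>k=1..n. lam k)) z
      \<longrightarrow> z \<in> zer (mean_operator mu A))"
    by (elim AE_E) blast
  have "measure P (space P - M) = 1"
    using M P.prob_compl[OF M(1)] by (simp add: measure_def)
  with M(1) * show ?thesis
    by (intro bexI[of _ "space P - M"]) auto
qed

end
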